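(* Let $\alpha\in(0,1)$, $\gamma\in\mathbb{R}$ and $\lambda_0,\lambda_1\ge 0$. Let the temporal meshes satisfy $\lambda_0\tau_j^{\alpha}<\{\Gamma(2-\alpha)\}^{-1}$ for all $j\ge 1$. Additionally, suppose that either (a) the meshes are quasi-graded with some grading parameter $r\ge 1$, or (b) $\gamma\le\alpha-1$ and $\max_j\tau_j$ is sufficiently small (i.e. $\max_j\tau_j\le\delta_0$ for a sufficiently small positive constant $\delta_0$ that does not depend on $M$). Then for every constant $C_0>0$ there is a constant $C_1>0$, independent of $M$ and $j$, such that every real sequence $\{U^j\}_{j=0}^M$ with $U^0=0$ and $$(\delta_t^\alpha-\lambda_0)U^j-\lambda_1U^{j-1}\le C_0\,(\tau/t_j)^{\gamma+1}\qquad\forall\, 1\le j\le M$$ satisfies $$U^j\le C_1\,\ell_\gamma(t_j)\,\tau\,t_j^{\alpha-1}\,(\tau/t_j)^{\min\{0,\gamma\}}\qquad\forall\,1\le j\le M,$$ where $\ell_\gamma(t_j):=1+\ln(t_j/\tau)$ if $\gamma=0$ and $\ell_\gamma(t_j):=1$ otherwise.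
   Context: Fix $T>0$. A family of temporal meshes $0=t_0<t_1<\dots<t_M=T$ is given, indexed by the positive integer $M$ (one mesh for each $M$ under consideration; the dependence of $t_j$ on $M$ is suppressed). Set $\tau_j:=t_j-t_{j-1}$ and $\tau:=t_1=\tau_1$. Quasi-graded with grading parameter $r\ge1$: there are positive constants $c_1,c_2,c_3$, independent of $M$ and $j$, such that $c_1M^{-r}\le\tau\le c_2M^{-r}$ and $\tau_j\le c_3\,\tau^{1/r}t_j^{1-1/r}$ for all $j=1,\dots,M$ (example: $t_j=T(j/M)^r$). The L1 discrete fractional-derivative operator is $$\delta_t^\alpha U^m:=\frac1{\Gamma(1-\alpha)}\sum_{j=1}^m\frac{U^j-U^{j-1}}{t_j-t_{j-1}}\int_{t_{j-1}}^{t_j}(t_m-s)^{-\alpha}\,ds .$$ All constants may depend on $T,\alpha,\gamma,\lambda_0,\lambda_1$, and on the family of meshes (e.g. on $r,c_1,c_2,c_3$), but not on $M$ or $j$. *)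

theory Defs
  imports "HOL-Analysis.Analysis"
begin

definition temporal_mesh :: "real \<Rightarrow> nat \<Rightarrow> (nat \<Rightarrow> real) \<Rightarrow> bool" where
  "temporal_mesh T M t \<longleftrightarrow>
     M \<ge> 1 \<and> t 0 = 0 \<and> t M = T \<and> (\<forall>j\<in>{1..M}. t (j - 1) < t j)"

definition mesh_step :: "(nat \<Rightarrow> real) \<Rightarrow> nat \<Rightarrow> real" where
  "mesh_step t j = t j - t (j - 1)"

definition max_mesh_step :: "(nat \<Rightarrow> real) \<Rightarrow> nat \<Rightarrow> real" where
  "max_mesh_step t M = Max (mesh_step t ` {1..M})"

text \<open>A family of meshes is a set \<open>Ms\<close> of admissible values of \<open>M\<close> together with
  nodes \<open>t M j\<close>; only \<open>M \<in> Ms\<close> and \<open>j \<le> M\<close> are meaningful. The first step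
  \<open>\<tau>\<close> is \<open>t M 1\<close>.\<close>

definition mesh_family :: "real \<Rightarrow> nat set \<Rightarrow> (nat \<Rightarrow> nat \<Rightarrow> real) \<Rightarrow> bool" where
  "mesh_family T Ms t \<longleftrightarrow> (\<forall>M\<in>Ms. temporal_mesh T M (t M))"

definition quasi_graded :: "nat set \<Rightarrow> (nat \<Rightarrow> nat \<Rightarrow> real) \<Rightarrow> real \<Rightarrow> bool" where
  "quasi_graded Ms t r \<longleftrightarrow>
     (\<exists>c1>0. \<exists>c2>0. \<exists>c3>0. \<forall>M\<in>Ms.
        c1 * real M powr (- r) \<le> t M 1 \<and> t M 1 \<le> c2 * real M powr (- r) \<and>
        (\<forall>j\<in>{1..M}. mesh_step (t M) j \<le> c3 * t M 1 powr (1 / r) * t M j powr (1 - 1 / r)))"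

text \<open>For \<open>j = m\<close> the integrand is singular at \<open>s = t m\<close>, where \<open>powr\<close> takes the value \<open>0\<close>;
  it is still integrable for \<open>\<alpha> < 1\<close>, so the integral is the usual improper one.\<close>

definition L1_op :: "real \<Rightarrow> (nat \<Rightarrow> real) \<Rightarrow> (nat \<Rightarrow> real) \<Rightarrow> nat \<Rightarrow> real" where
  "L1_op \<alpha> t U m =
     1 / Gamma (1 - \<alpha>) *
     (\<Sum>j=1..m. (U j - U (j - 1)) / (t j - t (j - 1)) *
        integral {t (j - 1)..t j} (\<lambda>s. (t m - s) powr (- \<alpha>)))"

definition log_factor :: "real \<Rightarrow> real \<Rightarrow> real \<Rightarrow> real" where
  "log_factor \<gamma> \<tau> x = (if \<gamma> = 0 then 1 + ln (x / \<tau>) else 1)"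

end

theory Submission
  imports Defs
begin

text \<open>
  By a discrete maximum principle it suffices to exhibit supersolutions. The basic one is
  \<open>V\<^sub>\<sigma>(s) = (s + \<sigma>) powr (\<alpha> - 1)\<close> for \<open>s > 0\<close> with \<open>V\<^sub>\<sigma>(0) = 0\<close>: up to the factor
  \<open>1 / Gamma (1 - \<alpha>)\<close> its Caputo derivative equals \<open>(\<sigma> / s) powr \<alpha> / (s + \<sigma>)\<close>, and on a
  quasi-graded mesh with \<open>\<sigma> \<ge> K \<tau>\<close> the L1 discretization error is at most a small multiple of
  \<open>(\<sigma> / s) powr \<rho> / (s + \<sigma>)\<close>. The latter may dominate for a single \<open>\<sigma>\<close>, but not after summation
  over the dyadic scales \<open>\<sigma>\<^sub>k = 2 ^ k * K \<tau>\<close> with weights \<open>\<sigma>\<^sub>k powr (- \<gamma>)\<close>; this sum is a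
  supersolution with residual of order \<open>s powr (- 1 - \<gamma>)\<close> and has exactly the claimed size.
  The terms with \<open>lam0\<close> and \<open>lam1\<close> are absorbed by a second such sum with a smaller exponent
  and by the sequence \<open>exp (\<mu> * t j)\<close>, \<open>j \<ge> 1\<close>, which for \<open>\<gamma> \<le> \<alpha> - 1\<close> is a
  sufficient barrier on every fine mesh. The finitely many coarse meshes of a quasi-graded family are
  handled individually.
\<close>

section \<open>The weights of the L1 operator and the comparison principle\<close>

text \<open>Setting \<open>V\<^sub>\<sigma>(0) = 0\<close> turns the Caputo derivative into the
  Riemann-Liouville one, which annihilates \<open>s powr (\<alpha> - 1)\<close>; the shift by
  \<sigma> removes the singularity and leaves a positive residual. On a graded mesh the relative
  step at time s is bounded by a power \<rho> of \<tau> / s, and \<rho> < \<alpha> keeps the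
  resulting error integrable against the kernel. As \<rho> < \<alpha>, the error bound exceeds the
  residual once s is much larger than \<sigma>, whatever K is. In the sum, the scale nearest to s
  supplies a residual of order \<open>s powr (- 1 - \<gamma>)\<close>, larger scales contribute
  positively, and the errors of smaller scales form a geometric series of the same order with a
  small factor. That series requires \<gamma> < \<rho>, while the size of the large scales is
  summable for \<gamma> > \<alpha> - 1. The two remaining ranges are treated separately: for
  \<gamma> \<ge> \<rho> a small positive exponent serves as well, because the claimed bound is the
  same for all positive \<gamma>; for \<gamma> \<le> \<alpha> - 1 the exponential sequence
  suffices.\<close>

lemma kernel_primitive_deriv:
  fixes \<alpha> c x :: real
  assumes "\<alpha> < 1" "x < c"
  shows "((\<lambda>s. - ((c - s) powr (1 - \<alpha>) / (1 - \<alpha>))) has_real_derivative (c - x) powr (- \<alpha>)) (at x)"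
proof -
  have "((\<lambda>s. - ((c - s) powr (1 - \<alpha>) / (1 - \<alpha>))) has_real_derivative
      - ((1 - \<alpha>) * (c - x) powr (1 - \<alpha> - 1) * (- 1) / (1 - \<alpha>))) (at x)"
    using assms by (intro derivative_eq_intros | simp)+
  then show ?thesis using assms by simp
qed

text \<open>For \<open>b = c\<close> the integrand is singular at the right end, but the primitive
  is continuous there since 1 - \<alpha> > 0, so a derivative in the interior is enough.\<close>

lemma kernel_has_integral:
  fixes \<alpha> a b c :: real
  assumes "0 < \<alpha>" "\<alpha> < 1" "a \<le> b" "b \<le> c"
  shows "((\<lambda>s. (c - s) powr (- \<alpha>)) has_integral
           ((c - a) powr (1 - \<alpha>) - (c - b) powr (1 - \<alpha>)) / (1 - \<alpha>)) {a..b}"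
proof -
  have "((\<lambda>s. (c - s) powr (- \<alpha>)) has_integral
      (- ((c - b) powr (1 - \<alpha>) / (1 - \<alpha>))) - (- ((c - a) powr (1 - \<alpha>) / (1 - \<alpha>)))) {a..b}"
  proof (rule fundamental_theorem_of_calculus_interior)
    show "continuous_on {a..b} (\<lambda>s. - ((c - s) powr (1 - \<alpha>) / (1 - \<alpha>)))"
      using assms by (intro continuous_intros continuous_on_powr') auto
    show "((\<lambda>s. - ((c - s) powr (1 - \<alpha>) / (1 - \<alpha>))) has_vector_derivative (c - x) powr (- \<alpha>)) (at x)"
      if "x \<in> {a<..<b}" for x
      unfolding has_real_derivative_iff_has_vector_derivative [symmetric]
      using that assms by (intro kernel_primitive_deriv) auto
  qed (use assms in auto)
  then show ?thesis by (simp add: diff_divide_distrib)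
qed

lemma DERIV_mean_value:
  fixes f f' :: "real \<Rightarrow> real"
  assumes "a < b" "continuous_on {a..b} f"
    and "\<And>x. a < x \<Longrightarrow> x < b \<Longrightarrow> (f has_real_derivative f' x) (at x)"
  obtains z where "a < z" "z < b" "f b - f a = (b - a) * f' z"
proof -
  have "\<exists>l z. a < z \<and> z < b \<and> (f has_real_derivative l) (at z) \<and> f b - f a = (b - a) * l"
    using assms by (intro MVT) (auto simp: real_differentiable_def)
  then show ?thesis using that assms(3) by (metis DERIV_unique)
qed

lemma kernel_integral_mean_value:
  fixes \<alpha> a b c :: real
  assumes "0 < \<alpha>" "\<alpha> < 1" "a < b" "b \<le> c"
  obtains z where "a < z" "z < b"
    "integral {a..b} (\<lambda>s. (c - s) powr (- \<alpha>)) = (b - a) * (c - z) powr (- \<alpha>)"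
proof -
  let ?F = "\<lambda>s. - ((c - s) powr (1 - \<alpha>) / (1 - \<alpha>))"
  have "continuous_on {a..b} ?F"
    using assms by (intro continuous_intros continuous_on_powr') auto
  moreover have "(?F has_real_derivative (c - x) powr (- \<alpha>)) (at x)" if "a < x" "x < b" for x
    using that assms by (intro kernel_primitive_deriv) auto
  ultimately obtain z where "a < z" "z < b" "?F b - ?F a = (b - a) * (c - z) powr (- \<alpha>)"
    using DERIV_mean_value[of a b ?F "\<lambda>x. (c - x) powr (- \<alpha>)"] assms by blast
  moreover have "integral {a..b} (\<lambda>s. (c - s) powr (- \<alpha>)) = ?F b - ?F a"
    using integral_unique[OF kernel_has_integral[of \<alpha> a b c]] assms
    by (simp add: diff_divide_distrib)
  ultimately show ?thesis using that by auto
qed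

locale L1_mesh =
  fixes \<alpha> :: real and t :: "nat \<Rightarrow> real" and M :: nat
  assumes \<alpha>: "0 < \<alpha>" "\<alpha> < 1"
    and t_0: "t 0 = 0"
    and t_step: "j \<in> {1..M} \<Longrightarrow> t (j - 1) < t j"
begin

lemma t_mono: "i \<le> j \<Longrightarrow> j \<le> M \<Longrightarrow> t i \<le> t j"
proof (induction rule: dec_induct)
  case (step n)
  then show ?case using t_step[of "Suc n"] by auto
qed auto

lemma t_strict: "i < j \<Longrightarrow> j \<le> M \<Longrightarrow> t i < t j"
  using t_mono[of i "j - 1"] t_step[of j] by force

lemma t_pos: "1 \<le> j \<Longrightarrow> j \<le> M \<Longrightarrow> 0 < t j"
  using t_strict[of 0 j] t_0 by auto

lemma t_nonneg: "j \<le> M \<Longrightarrow> 0 \<le> t j"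
  using t_mono[of 0 j] t_0 by auto

lemma t_1_le: "1 \<le> j \<Longrightarrow> j \<le> M \<Longrightarrow> t 1 \<le> t j"
  using t_mono[of 1 j] by auto

definition wt :: "nat \<Rightarrow> nat \<Rightarrow> real" where
  "wt m j = integral {t (j - 1)..t j} (\<lambda>s. (t m - s) powr (- \<alpha>)) / (t j - t (j - 1))"

definition L1_sum :: "(nat \<Rightarrow> real) \<Rightarrow> nat \<Rightarrow> real" where
  "L1_sum U m = (\<Sum>j=1..m. (U j - U (j - 1)) * wt m j)"

lemma L1_op_eq: "L1_op \<alpha> t U m = L1_sum U m / Gamma (1 - \<alpha>)"
  unfolding L1_op_def L1_sum_def wt_def by simp

text \<open>A cell mean of the kernel is its value at an interior point. As the kernel increases in
  s, positivity, the lower bound by the value at the left node and the monotonicity of the weights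
  all follow without a closed form.\<close>

lemma wt_mean_value:
  assumes "1 \<le> j" "j \<le> m" "m \<le> M"
  obtains z where "t (j - 1) < z" "z < t j" "wt m j = (t m - z) powr (- \<alpha>)"
proof -
  have "t (j - 1) < t j" "t j \<le> t m"
    using assms t_strict[of "j - 1" j] t_mono[of j m] by auto
  then obtain z where "t (j - 1) < z" "z < t j"
    "integral {t (j - 1)..t j} (\<lambda>s. (t m - s) powr (- \<alpha>)) = (t j - t (j - 1)) * (t m - z) powr (- \<alpha>)"
    using kernel_integral_mean_value[of \<alpha> "t (j - 1)" "t j" "t m"] \<alpha> by blast
  with that show ?thesis unfolding wt_def by auto
qed

lemma wt_ge:
  assumes "1 \<le> j" "j \<le> m" "m \<le> M"
  shows "(t m - t (j - 1)) powr (- \<alpha>) \<le> wt m j"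
proof -
  obtain z where z: "t (j - 1) < z" "z < t j" "wt m j = (t m - z) powr (- \<alpha>)"
    using wt_mean_value[OF assms] .
  then show ?thesis
    using \<alpha> t_mono[of j m] assms by (auto intro!: powr_mono2')
qed

lemma wt_pos:
  assumes "1 \<le> j" "j \<le> m" "m \<le> M"
  shows "0 < wt m j"
proof -
  have "t (j - 1) < t m" using assms t_strict[of "j - 1" m] by auto
  then show ?thesis using wt_ge[OF assms] by (smt (verit) powr_gt_zero)
qed

text \<open>The kernel value at the common node \<open>t j\<close> separates the two cell means;
  \<open>Suc j \<le> m\<close> keeps this node away from the singularity.\<close>

lemma wt_mono_Suc:
  assumes "1 \<le> j" "Suc j \<le> m" "m \<le> M"
  shows "wt m j \<le> wt m (Suc j)"
proof -
  obtain z where z: "t (j - 1) < z" "z < t j" "wt m j = (t m - z) powr (- \<alpha>)"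
    using wt_mean_value[of j m] assms by auto
  have "wt m j \<le> (t m - t j) powr (- \<alpha>)"
    using z \<alpha> t_strict[of j m] assms by (auto intro!: powr_mono2')
  then show ?thesis using wt_ge[of "Suc j" m] assms by simp
qed

lemma wt_mono:
  assumes "1 \<le> i" "i \<le> j" "j \<le> m" "m \<le> M"
  shows "wt m i \<le> wt m j"
  using assms(2,1,3,4)
proof (induction rule: dec_induct)
  case (step n)
  then show ?case using wt_mono_Suc[of n m] by auto
qed auto

lemma wt_integral:
  assumes "1 \<le> j" "j \<le> m" "m \<le> M"
  shows "(t j - t (j - 1)) * wt m j = integral {t (j - 1)..t j} (\<lambda>s. (t m - s) powr (- \<alpha>))"
  using t_strict[of "j - 1" j] assms unfolding wt_def by auto

text \<open>This is what the mesh condition is about: \<open>lam0 * mesh_step t j powr \<alpha> < 1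
  / Gamma (2 - \<alpha>)\<close> says that the diagonal coefficient of the L1 operator exceeds
  \<open>lam0\<close>.\<close>

lemma wt_diag:
  assumes "1 \<le> m" "m \<le> M"
  shows "wt m m / Gamma (1 - \<alpha>) = mesh_step t m powr (- \<alpha>) / Gamma (2 - \<alpha>)"
proof -
  have less: "t (m - 1) < t m" using t_strict[of "m - 1" m] assms by auto
  have "integral {t (m - 1)..t m} (\<lambda>s. (t m - s) powr (- \<alpha>)) = (t m - t (m - 1)) powr (1 - \<alpha>) / (1 - \<alpha>)"
    using integral_unique[OF kernel_has_integral[of \<alpha> "t (m - 1)" "t m" "t m"]] \<alpha> less by simp
  also have "(t m - t (m - 1)) powr (1 - \<alpha>) = (t m - t (m - 1)) * (t m - t (m - 1)) powr (- \<alpha>)"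
    using less powr_add[of "t m - t (m - 1)" 1 "- \<alpha>"] by simp
  finally have "wt m m = mesh_step t m powr (- \<alpha>) / (1 - \<alpha>)"
    unfolding wt_def mesh_step_def using less by simp
  moreover have "1 - \<alpha> \<notin> \<int>\<^sub>\<le>\<^sub>0"
    using \<alpha> nonpos_Ints_nonpos[of "1 - \<alpha>"] by auto
  then have "Gamma (2 - \<alpha>) = (1 - \<alpha>) * Gamma (1 - \<alpha>)"
    using Gamma_plus1[of "1 - \<alpha>"] by auto
  ultimately show ?thesis by simp
qed

text \<open>Summation by parts: the sum is \<open>wt m n * V n\<close> plus the terms
  \<open>(wt m j - wt m (Suc j)) * V j\<close> for 1 \<le> j < n and \<open>- wt m 1 * V 0\<close>,
  all nonnegative because the weights increase and the earlier values are nonpositive.\<close>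

lemma L1_sum_ge_last:
  assumes "1 \<le> n" "n \<le> m" "m \<le> M" "\<And>i. i < n \<Longrightarrow> V i \<le> 0"
  shows "wt m n * V n \<le> (\<Sum>j=1..n. (V j - V (j - 1)) * wt m j)"
  using assms(1,2,4)
proof (induction n rule: dec_induct)
  case base
  then show ?case using wt_pos[of 1 m] assms(3) by (simp add: algebra_simps mult_nonpos_nonneg)
next
  case (step n)
  have "(wt m n - wt m (Suc n)) * V n \<ge> 0"
    using step wt_mono_Suc[of n m] assms(3) by (intro mult_nonpos_nonpos) auto
  then show ?case using step by (simp add: algebra_simps)
qed

text \<open>Forward induction: once U - B is nonpositive at all earlier nodes, the history and the
  delay term have a favourable sign, and the diagonal coefficient minus \<open>lam0\<close> is
  positive. Stopping at n admits barriers that are themselves chosen in terms of n.\<close>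

lemma comparison:
  assumes diag: "\<And>j. j \<in> {1..n} \<Longrightarrow> lam0 * mesh_step t j powr \<alpha> < 1 / Gamma (2 - \<alpha>)"
    and lam1: "0 \<le> lam1" and "n \<le> M" and init: "U 0 \<le> B 0"
    and le: "\<And>j. j \<in> {1..n} \<Longrightarrow>
      L1_op \<alpha> t U j - lam0 * U j - lam1 * U (j - 1) \<le> L1_op \<alpha> t B j - lam0 * B j - lam1 * B (j - 1)"
  shows "j \<le> n \<Longrightarrow> U j \<le> B j"
proof (induction j rule: less_induct)
  case (less j)
  show ?case
  proof (cases "j = 0")
    case False
    then have j: "1 \<le> j" "j \<le> n" "j \<le> M" using less assms by auto
    define V where "V i = U i - B i" for i
    have neg: "V i \<le> 0" if "i < j" for i
      using less that by (auto simp: V_def)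
    have G: "Gamma (1 - \<alpha>) > 0" "Gamma (2 - \<alpha>) > 0" using \<alpha> by (auto intro: Gamma_real_pos)
    have "wt j j * V j \<le> L1_sum V j"
      unfolding L1_sum_def using L1_sum_ge_last[of j j V] j neg by auto
    then have "wt j j / Gamma (1 - \<alpha>) * V j \<le> L1_sum V j / Gamma (1 - \<alpha>)"
      using G by (simp add: divide_right_mono)
    also have "L1_sum V j = L1_sum U j - L1_sum B j"
      unfolding L1_sum_def V_def sum_subtractf[symmetric] by (intro sum.cong) (auto simp: algebra_simps)
    also have "(L1_sum U j - L1_sum B j) / Gamma (1 - \<alpha>) \<le> lam0 * V j + lam1 * V (j - 1)"
      using le[of j] j unfolding L1_op_eq V_def by (simp add: diff_divide_distrib algebra_simps)
    also have "\<dots> \<le> lam0 * V j"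
      using neg[of "j - 1"] j lam1 by (simp add: mult_nonneg_nonpos)
    finally have *: "(mesh_step t j powr (- \<alpha>) / Gamma (2 - \<alpha>) - lam0) * V j \<le> 0"
      using wt_diag[of j] j by (simp add: algebra_simps)
    have "mesh_step t j powr \<alpha> > 0" using t_step[of j] j by (auto simp: mesh_step_def)
    then have "lam0 < mesh_step t j powr (- \<alpha>) / Gamma (2 - \<alpha>)"
      using diag[of j] j G by (simp add: powr_minus divide_simps mult_ac)
    with * have "V j \<le> 0" by (simp add: mult_le_0_iff)
    then show ?thesis by (simp add: V_def)
  qed (use init in simp)
qed

section \<open>An exponential barrier\<close>

text \<open>Only the first increment sees index 0. The extra term is the contribution of the jump at
  time 0: it yields the \<open>t m powr (- \<alpha>)\<close> of the exponential barrier and balances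
  the decay of the shifted powers.\<close>

lemma L1_sum_zero_start:
  assumes "1 \<le> m"
  shows "L1_sum (\<lambda>i. if i = 0 then 0 else F i) m = L1_sum F m + F 0 * wt m 1"
proof -
  let ?E = "\<lambda>i. if i = 0 then 0 else F i"
  have *: "{1..m} = insert 1 {2..m}" using assms by auto
  have "(\<Sum>j=2..m. (?E j - ?E (j - 1)) * wt m j) = (\<Sum>j=2..m. (F j - F (j - 1)) * wt m j)"
    by (intro sum.cong) auto
  then show ?thesis unfolding L1_sum_def * by (simp add: algebra_simps)
qed

text \<open>Before time 1 / \<mu> the exponential is at most 3 and half of the jump term pays for
  \<open>lam\<close>. Later the increments over a window of length comparable to 1 / \<mu> do, since
  the weights there are at least of order \<open>\<mu> powr \<alpha>\<close>.\<close>

lemma exp_barrier: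
  assumes m: "1 \<le> m" "m \<le> M" and \<mu>: "0 < \<mu>" and lam: "0 \<le> lam" "6 * lam \<le> \<mu> powr \<alpha>"
    and step: "\<And>j. j \<in> {1..m} \<Longrightarrow> mesh_step t j \<le> 1 / \<mu>"
  shows "t m powr (- \<alpha>) / 2 \<le> L1_sum (\<lambda>i. if i = 0 then 0 else exp (\<mu> * t i)) m - lam * exp (\<mu> * t m)"
proof -
  define F where "F i = exp (\<mu> * t i)" for i
  have tm: "0 < t m" using t_pos m by auto
  have F_mono: "F (j - 1) \<le> F j" if "j \<in> {1..m}" for j
    using t_step[of j] that m \<mu> by (auto simp: F_def)
  have eq: "L1_sum (\<lambda>i. if i = 0 then 0 else F i) m = L1_sum F m + wt m 1"
    using L1_sum_zero_start[of m F] m by (simp add: F_def[of 0] t_0)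
  have wt1: "t m powr (- \<alpha>) \<le> wt m 1" using wt_ge[of 1 m] m t_0 by auto
  have nonneg: "0 \<le> (F j - F (j - 1)) * wt m j" if "j \<in> {1..m}" for j
    using F_mono[OF that] wt_pos[of j m] that m by simp
  show ?thesis
  proof (cases "\<mu> * t m \<ge> 1")
    case True
    \<comment> \<open>The last node at distance at least 1 / \<mu> from \<open>t m\<close>. Steps do
      not exceed 1 / \<mu>, so the window from \<open>t p\<close> to \<open>t m\<close> has length
      between 1 / \<mu> and 2 / \<mu>.\<close>
    define p where "p = Max {i. i \<le> m \<and> t i \<le> t m - 1 / \<mu>}"
    have fin: "finite {i. i \<le> m \<and> t i \<le> t m - 1 / \<mu>}" by simp
    have "0 \<in> {i. i \<le> m \<and> t i \<le> t m - 1 / \<mu>}" using True \<mu> t_0 by (simp add: field_simps)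
    then have p: "p \<le> m" "t p \<le> t m - 1 / \<mu>"
      using Max_in[OF fin] unfolding p_def by blast+
    have "p \<noteq> m" using p \<mu> by auto
    then have "p < m" using p by simp
    have "\<not> t (Suc p) \<le> t m - 1 / \<mu>"
      using Max_ge[OF fin, of "Suc p"] \<open>p < m\<close> unfolding p_def[symmetric] by auto
    then have tp: "t m - t p \<le> 2 / \<mu>" using step[of "Suc p"] \<open>p < m\<close> by (auto simp: mesh_step_def)
    have tp0: "0 < t m - t p" using p \<mu> by (smt (verit) divide_pos_pos)
    have "\<mu> powr \<alpha> / 2 \<le> \<mu> powr \<alpha> / 2 powr \<alpha>"
      using \<alpha> powr_mono[of \<alpha> 1 2] by (intro divide_left_mono) auto
    also have "\<dots> = (2 / \<mu>) powr (- \<alpha>)" using \<mu> by (simp add: powr_minus powr_divide)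
    also have "\<dots> \<le> (t m - t p) powr (- \<alpha>)" using \<alpha> tp tp0 by (intro powr_mono2') auto
    also have "\<dots> \<le> wt m (Suc p)" using wt_ge[of "Suc p" m] \<open>p < m\<close> m by auto
    finally have w: "\<mu> powr \<alpha> / 2 \<le> wt m (Suc p)" .
    have "\<mu> * t p + 1 \<le> \<mu> * t m" using p \<mu> by (simp add: field_simps)
    then have "exp (\<mu> * t p) * exp 1 \<le> F m" unfolding F_def exp_add[symmetric] by simp
    moreover have "2 * F p \<le> F p * exp 1" using exp_ge_add_one_self[of 1] by (simp add: F_def)
    ultimately have Fp: "F m / 2 \<le> F m - F p" unfolding F_def by linarith
    \<comment> \<open>Freezing the weights at that of the first cell of the window makes the
      increments telescope.\<close>
    have "\<mu> powr \<alpha> / 2 * (F m / 2) \<le> wt m (Suc p) * (F m - F p)"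
      using w Fp by (intro mult_mono) (auto simp: F_def intro: order_trans[OF _ w])
    also have "\<dots> = (\<Sum>j=Suc p..m. (F j - F (j - 1)) * wt m (Suc p))"
      using sum_telescope''[of p m F] \<open>p < m\<close> by (simp add: sum_distrib_right[symmetric] del: sum_telescope'')
    also have "\<dots> \<le> (\<Sum>j=Suc p..m. (F j - F (j - 1)) * wt m j)"
      using wt_mono m F_mono by (intro sum_mono mult_left_mono) auto
    also have "\<dots> \<le> L1_sum F m"
      unfolding L1_sum_def using nonneg by (intro sum_mono2) auto
    finally have "\<mu> powr \<alpha> * F m / 4 \<le> L1_sum F m" by simp
    moreover have "6 * lam * F m \<le> \<mu> powr \<alpha> * F m" using lam by (intro mult_right_mono) (auto simp: F_def)
    moreover have "0 \<le> \<mu> powr \<alpha> * F m" by (simp add: F_def)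
    moreover have "0 \<le> t m powr (- \<alpha>)" by simp
    ultimately show ?thesis using wt1 unfolding F_def[symmetric] eq by linarith
  next
    case False
    have "\<mu> \<le> 1 / t m" using False tm by (simp add: field_simps)
    then have "\<mu> powr \<alpha> \<le> (1 / t m) powr \<alpha>" using \<alpha> \<mu> by (intro powr_mono2) auto
    then have "6 * lam \<le> t m powr (- \<alpha>)" using lam tm by (simp add: powr_minus_divide powr_divide)
    \<comment> \<open>The hypothesis constant 6 is 2 * 3: this bound together with half of the jump
      term.\<close>
    moreover have "F m \<le> 3" using False exp_le by (auto simp: F_def intro: order_trans[of _ "exp 1"])
    then have "lam * F m \<le> lam * 3" using lam by (intro mult_left_mono) auto
    moreover have "0 \<le> L1_sum F m" unfolding L1_sum_def using nonneg by (intro sum_nonneg) auto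
    ultimately show ?thesis using wt1 unfolding F_def[symmetric] eq by linarith
  qed
qed

end

section \<open>Power-type barriers\<close>

lemma shifted_power_kernel_has_integral:
  fixes \<alpha> \<sigma> c :: real
  assumes "0 < \<alpha>" "\<alpha> < 1" "0 < \<sigma>" "0 < c"
  shows "((\<lambda>s. (s + \<sigma>) powr (\<alpha> - 2) * (c - s) powr (- \<alpha>)) has_integral
           (c / \<sigma>) powr (1 - \<alpha>) / ((1 - \<alpha>) * (c + \<sigma>))) {0..c}"
proof -
  \<comment> \<open>The exponents of the integrand add up to -2, so the substitution
    \<open>y = (c - s) / (s + \<sigma>)\<close> reduces it to a multiple of
    \<open>y powr (- \<alpha>)\<close>.\<close>
  let ?P = "\<lambda>s. - (((c - s) / (s + \<sigma>)) powr (1 - \<alpha>) / ((1 - \<alpha>) * (c + \<sigma>)))"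
  have "((\<lambda>s. (s + \<sigma>) powr (\<alpha> - 2) * (c - s) powr (- \<alpha>)) has_integral ?P c - ?P 0) {0..c}"
  proof (rule fundamental_theorem_of_calculus_interior)
    show "continuous_on {0..c} ?P"
      using assms by (intro continuous_intros continuous_on_powr') auto
    fix x assume x: "x \<in> {0<..<c}"
    let ?y = "(c - x) / (x + \<sigma>)"
    have y: "?y > 0" using x assms by auto
    have "((\<lambda>s. (c - s) / (s + \<sigma>)) has_real_derivative - ((c + \<sigma>) / (x + \<sigma>)\<^sup>2)) (at x)"
    proof -
      have "((\<lambda>s. (c - s) / (s + \<sigma>)) has_real_derivative
          ((0 - 1) * (x + \<sigma>) - (c - x) * (1 + 0)) / ((x + \<sigma>) * (x + \<sigma>))) (at x)"
        using x assms by (intro DERIV_divide DERIV_diff DERIV_add DERIV_ident DERIV_const) auto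
      moreover have "(0 - 1) * (x + \<sigma>) - (c - x) * (1 + 0) = - (c + \<sigma>)" by simp
      ultimately show ?thesis by (simp only: power2_eq_square minus_divide_left)
    qed
    from DERIV_powr[OF this y, of "\<lambda>_. 1 - \<alpha>" 0]
    have "((\<lambda>s. ((c - s) / (s + \<sigma>)) powr (1 - \<alpha>)) has_real_derivative
        ?y powr (1 - \<alpha>) * (- ((c + \<sigma>) / (x + \<sigma>)\<^sup>2) * (1 - \<alpha>) / ?y)) (at x)"
      by simp
    then have "(?P has_real_derivative
        - (?y powr (1 - \<alpha>) * (- ((c + \<sigma>) / (x + \<sigma>)\<^sup>2) * (1 - \<alpha>) / ?y) / ((1 - \<alpha>) * (c + \<sigma>)))) (at x)"
      by (intro DERIV_minus DERIV_cdivide)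
    also have "- (?y powr (1 - \<alpha>) * (- ((c + \<sigma>) / (x + \<sigma>)\<^sup>2) * (1 - \<alpha>) / ?y) / ((1 - \<alpha>) * (c + \<sigma>)))
        = ?y powr (1 - \<alpha>) / ?y / (x + \<sigma>)\<^sup>2"
    proof -
      have ne: "1 - \<alpha> \<noteq> 0" "c + \<sigma> \<noteq> 0" using assms by auto
      have "- (Y * (- (C / D) * A / y) / (A * C)) = Y / y / D" if "A \<noteq> 0" "C \<noteq> 0" for A C D y Y :: real
        using that by simp
      from this[OF ne] show ?thesis .
    qed
    also have "?y powr (1 - \<alpha>) / ?y = ?y powr (- \<alpha>)"
    proof -
      have "?y powr (1 - \<alpha>) = ?y powr (- \<alpha>) * ?y powr 1" unfolding powr_add[symmetric] by simp
      then show ?thesis using y by (simp only: powr_one less_imp_le) simp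
    qed
    also have "\<dots> = (c - x) powr (- \<alpha>) / (x + \<sigma>) powr (- \<alpha>)"
      using x assms by (simp add: powr_divide)
    also have "\<dots> / (x + \<sigma>)\<^sup>2 = (x + \<sigma>) powr (\<alpha> - 2) * (c - x) powr (- \<alpha>)"
      using x assms by (simp add: powr_diff powr_minus powr_numeral field_simps)
    finally show "(?P has_vector_derivative (x + \<sigma>) powr (\<alpha> - 2) * (c - x) powr (- \<alpha>)) (at x)"
      unfolding has_real_derivative_iff_has_vector_derivative .
  qed (use assms in auto)
  then show ?thesis by simp
qed

lemma shifted_power_deriv:
  fixes \<alpha> \<sigma> x :: real
  assumes "0 < x + \<sigma>"
  shows "((\<lambda>s. (s + \<sigma>) powr (\<alpha> - 1)) has_real_derivative - ((1 - \<alpha>) * (x + \<sigma>) powr (\<alpha> - 2))) (at x)"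
proof -
  have "((\<lambda>s. s + \<sigma>) has_real_derivative 1) (at x)" by (auto intro!: derivative_eq_intros)
  from DERIV_fun_powr[OF this assms, of "\<alpha> - 1"] show ?thesis by (simp add: algebra_simps)
qed

lemma shifted_power_has_integral:
  fixes \<alpha> \<sigma> a b :: real
  assumes "\<alpha> < 1" "0 < a + \<sigma>" "a \<le> b"
  shows "((\<lambda>s. (1 - \<alpha>) * (s + \<sigma>) powr (\<alpha> - 2)) has_integral
           (a + \<sigma>) powr (\<alpha> - 1) - (b + \<sigma>) powr (\<alpha> - 1)) {a..b}"
proof -
  have "((\<lambda>s. - ((1 - \<alpha>) * (s + \<sigma>) powr (\<alpha> - 2))) has_integral
      (b + \<sigma>) powr (\<alpha> - 1) - (a + \<sigma>) powr (\<alpha> - 1)) {a..b}"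
  proof (rule fundamental_theorem_of_calculus)
    fix x assume "x \<in> {a..b}"
    then have "0 < x + \<sigma>" using assms by auto
    from shifted_power_deriv[OF this, of \<alpha>]
    show "((\<lambda>s. (s + \<sigma>) powr (\<alpha> - 1)) has_vector_derivative - ((1 - \<alpha>) * (x + \<sigma>) powr (\<alpha> - 2))) (at x within {a..b})"
      unfolding has_real_derivative_iff_has_vector_derivative by (rule has_vector_derivative_at_within)
  qed (use assms in auto)
  from has_integral_neg[OF this] show ?thesis by simp
qed

text \<open>Serves to integrate the bound on the discretization error, which is singular at both
  ends of the interval.\<close>

lemma Beta_has_integral_scaled:
  fixes a b c :: real
  assumes "0 < a" "0 < b" "0 < c"
  shows "((\<lambda>s. s powr (a - 1) * (c - s) powr (b - 1)) has_integral c powr (a + b - 1) * Beta a b) {0..c}"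
proof -
  have "((\<lambda>s. (s / c) powr (a - 1) * (1 - s / c) powr (b - 1)) has_integral c * Beta a b) {0..c}"
  proof -
    have "((\<lambda>x. (\<lambda>s. s powr (a - 1) * (1 - s) powr (b - 1)) ((1 / c) *\<^sub>R x + 0)) has_integral
        (1 / (\<bar>1 / c\<bar> ^ DIM(real))) *\<^sub>R Beta a b) ((\<lambda>x. (1 / (1 / c)) *\<^sub>R x + -((1 / (1 / c)) *\<^sub>R 0)) ` cbox 0 1)"
      using assms has_integral_Beta_real[of a b] by (intro has_integral_affinity) auto
    then show ?thesis using assms by simp
  qed
  then have "((\<lambda>s. c powr (a + b - 2) * ((s / c) powr (a - 1) * (1 - s / c) powr (b - 1))) has_integral
      c powr (a + b - 2) * (c * Beta a b)) {0..c}"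
    by (rule has_integral_mult_right)
  then have "((\<lambda>s. c powr (a + b - 2) * ((s / c) powr (a - 1) * (1 - s / c) powr (b - 1))) has_integral
      c powr (a + b - 1) * Beta a b) {0..c}"
    using assms powr_add[of c "a + b - 2" 1] by (simp add: mult_ac)
  moreover have "c powr (a + b - 2) * ((s / c) powr (a - 1) * (1 - s / c) powr (b - 1)) =
      s powr (a - 1) * (c - s) powr (b - 1)" if "s \<in> {0..c}" for s
  proof -
    have "1 - s / c = (c - s) / c" using assms by (simp add: field_simps)
    moreover have "c powr (a + b - 2) = c powr (a - 1) * c powr (b - 1)"
      using powr_add[of c "a - 1" "b - 1"] by simp
    ultimately show ?thesis using that assms by (simp add: powr_divide)
  qed
  ultimately show ?thesis by (rule has_integral_eq[rotated])
qed

section \<open>Discretization error on a single cell\<close>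

lemma difference_quotient_bounds:
  fixes \<alpha> \<sigma> a b s \<epsilon> \<rho> :: real
  assumes \<alpha>: "0 < \<alpha>" "\<alpha> < 1" and \<sigma>: "0 < \<sigma>" and "0 \<le> \<rho>" and ab: "0 \<le> a" "a < b" and s: "a \<le> s" "s \<le> b"
    and small: "b - a \<le> a + \<sigma>" "3 * ((b - a) / (a + \<sigma>)) \<le> \<epsilon> * (\<sigma> / (b + \<sigma>)) powr \<rho>" and "0 \<le> \<epsilon>"
  defines "d \<equiv> ((a + \<sigma>) powr (\<alpha> - 1) - (b + \<sigma>) powr (\<alpha> - 1)) / (b - a)"
  shows "(1 - \<alpha>) * (b + \<sigma>) powr (\<alpha> - 2) \<le> d"
    and "d \<le> (1 - \<alpha>) * (s + \<sigma>) powr (\<alpha> - 2) * (1 + \<epsilon> * (\<sigma> / (s + \<sigma>)) powr \<rho>)"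
proof -
  have "continuous_on {a..b} (\<lambda>s. (s + \<sigma>) powr (\<alpha> - 1))"
    using ab \<sigma> by (intro continuous_intros) auto
  then obtain z where z: "a < z" "z < b"
    and eq: "(b + \<sigma>) powr (\<alpha> - 1) - (a + \<sigma>) powr (\<alpha> - 1) = (b - a) * - ((1 - \<alpha>) * (z + \<sigma>) powr (\<alpha> - 2))"
    using DERIV_mean_value[of a b "\<lambda>s. (s + \<sigma>) powr (\<alpha> - 1)" "\<lambda>x. - ((1 - \<alpha>) * (x + \<sigma>) powr (\<alpha> - 2))"]
      shifted_power_deriv ab \<sigma> by auto
  have "(a + \<sigma>) powr (\<alpha> - 1) - (b + \<sigma>) powr (\<alpha> - 1) = (b - a) * ((1 - \<alpha>) * (z + \<sigma>) powr (\<alpha> - 2))"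
    using eq by linarith
  \<comment> \<open>So d is minus the derivative at an interior point of the cell and lies between
    the values at its two ends.\<close>
  then have d: "d = (1 - \<alpha>) * (z + \<sigma>) powr (\<alpha> - 2)" unfolding d_def using ab by simp
  show "(1 - \<alpha>) * (b + \<sigma>) powr (\<alpha> - 2) \<le> d"
    unfolding d using z ab \<sigma> \<alpha> by (intro mult_left_mono powr_mono2') auto
  define h where "h = (b - a) / (a + \<sigma>)"
  have h: "0 \<le> h" "h \<le> 1" using ab \<sigma> small by (auto simp: h_def)
  define x where "x = (s + \<sigma>) / (a + \<sigma>)"
  have "1 + h = (b + \<sigma>) / (a + \<sigma>)" using ab \<sigma> by (simp add: h_def field_simps)
  then have x: "1 \<le> x" "x \<le> 1 + h" using ab \<sigma> s by (auto simp: x_def divide_right_mono)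
  \<comment> \<open>As x \<ge> 1 the exponent may be raised to 2; \<open>h * h \<le> h\<close> then
    produces the 3 of the smallness hypothesis.\<close>
  have "x powr (2 - \<alpha>) \<le> x powr 2" using x \<alpha> by (intro powr_mono) auto
  also have "\<dots> = x\<^sup>2" using x by (simp add: powr_numeral)
  also have "\<dots> \<le> (1 + h)\<^sup>2" using x by (intro power_mono) auto
  also have "\<dots> \<le> 1 + 3 * h" using mult_left_mono[OF h(2) h(1)] by (simp add: power2_eq_square algebra_simps)
  also have "\<dots> \<le> 1 + \<epsilon> * (\<sigma> / (b + \<sigma>)) powr \<rho>" using small by (simp add: h_def)
  also have "\<dots> \<le> 1 + \<epsilon> * (\<sigma> / (s + \<sigma>)) powr \<rho>"
    using assms by (intro add_left_mono mult_left_mono powr_mono2 divide_left_mono) auto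
  finally have x2: "x powr (2 - \<alpha>) \<le> 1 + \<epsilon> * (\<sigma> / (s + \<sigma>)) powr \<rho>" .
  have "d \<le> (1 - \<alpha>) * (a + \<sigma>) powr (\<alpha> - 2)"
    unfolding d using z ab \<sigma> \<alpha> by (intro mult_left_mono powr_mono2') auto
  also have "(a + \<sigma>) powr (\<alpha> - 2) = (s + \<sigma>) powr (\<alpha> - 2) * x powr (2 - \<alpha>)"
  proof -
    have "x powr (2 - \<alpha>) = (s + \<sigma>) powr (2 - \<alpha>) / (a + \<sigma>) powr (2 - \<alpha>)"
      unfolding x_def using ab s \<sigma> by (simp add: powr_divide)
    moreover have "(a + \<sigma>) powr (\<alpha> - 2) = 1 / (a + \<sigma>) powr (2 - \<alpha>)"
      "(s + \<sigma>) powr (\<alpha> - 2) = 1 / (s + \<sigma>) powr (2 - \<alpha>)"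
      using powr_minus_divide[of _ "2 - \<alpha>"] by auto
    moreover have "(s + \<sigma>) powr (2 - \<alpha>) > 0" using ab s \<sigma> by simp
    ultimately show ?thesis by simp
  qed
  also have "(1 - \<alpha>) * ((s + \<sigma>) powr (\<alpha> - 2) * x powr (2 - \<alpha>)) \<le>
      (1 - \<alpha>) * (s + \<sigma>) powr (\<alpha> - 2) * (1 + \<epsilon> * (\<sigma> / (s + \<sigma>)) powr \<rho>)"
    unfolding mult.assoc using x2 \<alpha> by (intro mult_left_mono) auto
  finally show "d \<le> (1 - \<alpha>) * (s + \<sigma>) powr (\<alpha> - 2) * (1 + \<epsilon> * (\<sigma> / (s + \<sigma>)) powr \<rho>)" .
qed

text \<open>The increment of the kernel gains a factor s because
  \<open>(c - s) powr (1 - \<alpha>) \<le> c powr (1 - \<alpha>)\<close>. That factor is spent on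
  \<open>s / (s + \<sigma>) \<le> c / (c + \<sigma>)\<close>, which replaces 1 / c by 1 / (c +
  \<sigma>); the remaining power of s is integrable at 0 since \<rho> < \<alpha>.\<close>

lemma kernel_increment_bound:
  fixes \<alpha> \<sigma> \<rho> s c :: real
  assumes \<alpha>: "0 < \<alpha>" "\<alpha> < 1" and \<sigma>: "0 < \<sigma>" and \<rho>: "0 \<le> \<rho>" "\<rho> < \<alpha>" and s: "0 \<le> s" "s < c"
  shows "(s + \<sigma>) powr (\<alpha> - 2) * (\<sigma> / (s + \<sigma>)) powr \<rho> * ((c - s) powr (- \<alpha>) - c powr (- \<alpha>)) \<le>
     \<sigma> powr \<rho> / (c + \<sigma>) * (s powr (\<alpha> - \<rho> - 1) * (c - s) powr (- \<alpha>))"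
proof (cases "s = 0")
  case False
  then have s': "0 < s" using s by simp
  let ?k = "(c - s) powr (- \<alpha>)"
  have "?k * (c - s) = (c - s) powr (1 - \<alpha>)" using powr_add[of "c - s" "- \<alpha>" 1] s by simp
  also have "\<dots> \<le> c powr (1 - \<alpha>)" using s \<alpha> by (intro powr_mono2) auto
  also have "\<dots> = c powr (- \<alpha>) * c" using powr_add[of c "- \<alpha>" 1] s by simp
  finally have "?k - c powr (- \<alpha>) \<le> s / c * ?k" using s by (simp add: field_simps)
  then have "(s + \<sigma>) powr (\<alpha> - 2) * (\<sigma> / (s + \<sigma>)) powr \<rho> * (?k - c powr (- \<alpha>)) \<le>
      (s + \<sigma>) powr (\<alpha> - 2) * (\<sigma> / (s + \<sigma>)) powr \<rho> * (s / c * ?k)"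
    by (intro mult_left_mono) auto
  also have "\<dots> = \<sigma> powr \<rho> / c * (s / (s + \<sigma>)) * (s + \<sigma>) powr (\<alpha> - \<rho> - 1) * ?k"
  proof -
    have "(s + \<sigma>) powr (\<alpha> - 2) = (s + \<sigma>) powr (\<alpha> - \<rho> - 1) * (s + \<sigma>) powr \<rho> / (s + \<sigma>)"
      using powr_add[of "s + \<sigma>" "\<alpha> - \<rho> - 1" \<rho>] powr_diff[of "s + \<sigma>" "\<alpha> - 1" 1] s' \<sigma> by simp
    moreover have "(\<sigma> / (s + \<sigma>)) powr \<rho> = \<sigma> powr \<rho> / (s + \<sigma>) powr \<rho>"
      using s' \<sigma> by (simp add: powr_divide)
    moreover have "(s + \<sigma>) powr \<rho> \<noteq> 0" using s' \<sigma> by simp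
    ultimately show ?thesis by (simp add: mult_ac)
  qed
  also have "\<dots> \<le> \<sigma> powr \<rho> / c * (c / (c + \<sigma>)) * s powr (\<alpha> - \<rho> - 1) * ?k"
  proof -
    have "s / (s + \<sigma>) \<le> c / (c + \<sigma>)" using s \<sigma> by (simp add: field_simps)
    moreover have "(s + \<sigma>) powr (\<alpha> - \<rho> - 1) \<le> s powr (\<alpha> - \<rho> - 1)"
      using s' \<sigma> \<alpha> \<rho> by (intro powr_mono2') auto
    ultimately show ?thesis using s' s \<sigma> by (intro mult_right_mono mult_mono mult_left_mono) auto
  qed
  also have "\<dots> = \<sigma> powr \<rho> / (c + \<sigma>) * (s powr (\<alpha> - \<rho> - 1) * ?k)"
    using s by simp
  finally show ?thesis .
qed simp


context L1_mesh
begin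

lemma integral_sum_cells:
  assumes "n \<le> M" "(f :: real \<Rightarrow> real) integrable_on {0..t n}"
  shows "(\<Sum>j=1..n. integral {t (j - 1)..t j} f) = integral {0..t n} f"
  using assms
proof (induction n)
  case (Suc n)
  have le: "0 \<le> t n" "t n \<le> t (Suc n)" using t_nonneg t_mono[of n "Suc n"] Suc by auto
  have "f integrable_on {0..t n}"
    using Suc.prems(2) le by (rule_tac integrable_on_subinterval) auto
  then have "(\<Sum>j=1..n. integral {t (j - 1)..t j} f) = integral {0..t n} f"
    using Suc by simp
  moreover have "integral {0..t n} f + integral {t n..t (Suc n)} f = integral {0..t (Suc n)} f"
    using Henstock_Kurzweil_Integration.integral_combine[OF le Suc.prems(2)] .
  ultimately show ?case by simp
qed (simp add: t_0)

text \<open>With \<open>k s = (t m - s) powr (- \<alpha>)\<close>, replacing \<open>k\<close> by \<open>k - k 0\<close> does not change the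
  discretization error, and \<open>k s - k 0 \<le> s / t m * k s\<close> supplies the factor \<open>s\<close> that makes the
  error estimate uniform near \<open>s = 0\<close>.\<close>

lemma power_barrier:
  assumes m: "1 \<le> m" "m \<le> M" and \<sigma>: "0 < \<sigma>" and \<rho>: "0 \<le> \<rho>" "\<rho> < \<alpha>" and \<epsilon>: "0 \<le> \<epsilon>"
    and small: "\<And>j. j \<in> {1..m} \<Longrightarrow> mesh_step t j \<le> t (j - 1) + \<sigma>"
      "\<And>j. j \<in> {1..m} \<Longrightarrow> 3 * (mesh_step t j / (t (j - 1) + \<sigma>)) \<le> \<epsilon> * (\<sigma> / (t j + \<sigma>)) powr \<rho>"
  shows "((\<sigma> / t m) powr \<alpha> - \<epsilon> * (1 - \<alpha>) * Beta (\<alpha> - \<rho>) (1 - \<alpha>) * (\<sigma> / t m) powr \<rho>) / (t m + \<sigma>)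
    \<le> L1_sum (\<lambda>i. if i = 0 then 0 else (t i + \<sigma>) powr (\<alpha> - 1)) m"
proof -
  define c where "c = t m"
  have c: "0 < c" using t_pos m by (simp add: c_def)
  define k where "k s = (c - s) powr (- \<alpha>)" for s
  define k0 where "k0 = c powr (- \<alpha>)"
  define v where "v s = (s + \<sigma>) powr (\<alpha> - 1)" for s
  define p where "p s = (1 - \<alpha>) * (s + \<sigma>) powr (\<alpha> - 2)" for s
  define b where "b s = s powr (\<alpha> - \<rho> - 1) * (c - s) powr (- \<alpha>)" for s
  define D where "D = \<epsilon> * (1 - \<alpha>) * \<sigma> powr \<rho> / (c + \<sigma>)"
  \<comment> \<open>A pointwise majorant: the exact integrand for the kernel \<open>k - k0\<close>,
    plus the error caused by replacing minus the derivative by the difference quotient.\<close>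
  define q where "q s = (p s * k s - k0 * p s) + D * b s" for s
  have D: "0 \<le> D" using \<alpha> \<epsilon> c \<sigma> by (simp add: D_def)
  have k_int: "((\<lambda>s. p s * k s) has_integral (c / \<sigma>) powr (1 - \<alpha>) / (c + \<sigma>)) {0..c}"
  proof -
    have "((\<lambda>s. (1 - \<alpha>) * ((s + \<sigma>) powr (\<alpha> - 2) * (c - s) powr (- \<alpha>))) has_integral
        (1 - \<alpha>) * ((c / \<sigma>) powr (1 - \<alpha>) / ((1 - \<alpha>) * (c + \<sigma>)))) {0..c}"
      using shifted_power_kernel_has_integral[of \<alpha> \<sigma> c] \<alpha> \<sigma> c by (intro has_integral_mult_right)
    moreover have "(1 - \<alpha>) * ((c / \<sigma>) powr (1 - \<alpha>) / ((1 - \<alpha>) * (c + \<sigma>))) = (c / \<sigma>) powr (1 - \<alpha>) / (c + \<sigma>)"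
      using \<alpha> by simp
    ultimately show ?thesis unfolding p_def k_def by (simp add: mult.assoc)
  qed
  have p_int: "(p has_integral v 0 - v c) {0..c}"
    using shifted_power_has_integral[of \<alpha> 0 \<sigma> c] \<alpha> \<sigma> c unfolding p_def v_def by simp
  have b_int: "(b has_integral c powr (- \<rho>) * Beta (\<alpha> - \<rho>) (1 - \<alpha>)) {0..c}"
    using Beta_has_integral_scaled[of "\<alpha> - \<rho>" "1 - \<alpha>" c] \<alpha> \<rho> c unfolding b_def by simp
  have q_int: "(q has_integral (c / \<sigma>) powr (1 - \<alpha>) / (c + \<sigma>) - k0 * (v 0 - v c)
      + D * (c powr (- \<rho>) * Beta (\<alpha> - \<rho>) (1 - \<alpha>))) {0..c}"
    unfolding q_def using k_int p_int b_int
    by (intro has_integral_add has_integral_diff has_integral_mult_right)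
  have cell: "(v (t (j - 1)) - v (t j)) * (wt m j - k0) \<le> integral {t (j - 1)..t j} q" if j: "j \<in> {1..m}" for j
  proof -
    let ?a = "t (j - 1)" and ?b = "t j"
    define d where "d = (v ?a - v ?b) / (?b - ?a)"
    have ab: "0 \<le> ?a" "?a < ?b" "?b \<le> c"
      using t_nonneg[of "j - 1"] t_step[of j] t_mono[of j m] j m by (auto simp: c_def)
    have bounds: "(1 - \<alpha>) * (?b + \<sigma>) powr (\<alpha> - 2) \<le> d"
      "d \<le> (1 - \<alpha>) * (s + \<sigma>) powr (\<alpha> - 2) * (1 + \<epsilon> * (\<sigma> / (s + \<sigma>)) powr \<rho>)"
      if "s \<in> {?a..?b}" for s
      using difference_quotient_bounds[OF \<alpha> \<sigma> \<rho>(1) ab(1,2), of s \<epsilon>] small[OF j] \<epsilon> that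
      unfolding d_def v_def mesh_step_def by auto
    have pw: "d * (k s - k0) \<le> q s" if s: "s \<in> {?a..?b}" for s
    proof (cases "s = c")
      case True
      \<comment> \<open>At \<open>s = c\<close> the kernel takes its default value 0, so
        \<open>k s - k0\<close> is negative and the lower bound on the difference quotient is the
        relevant one.\<close>
      then have "p s \<le> d" using bounds(1)[OF s] s ab by (simp add: p_def)
      then have "d * k0 \<ge> p s * k0" by (intro mult_right_mono) (auto simp: k0_def)
      then show ?thesis using True D by (simp add: q_def k_def b_def mult.commute)
    next
      case False
      then have s': "0 \<le> s" "s < c" using s ab by auto
      have "k0 \<le> k s" unfolding k_def k0_def using s' \<alpha> by (intro powr_mono2') auto
      then have "d * (k s - k0) \<le>
          (1 - \<alpha>) * (s + \<sigma>) powr (\<alpha> - 2) * (1 + \<epsilon> * (\<sigma> / (s + \<sigma>)) powr \<rho>) * (k s - k0)"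
        using bounds(2)[OF s] by (intro mult_right_mono) auto
      also have "\<dots> = p s * k s - k0 * p s +
          \<epsilon> * (1 - \<alpha>) * ((s + \<sigma>) powr (\<alpha> - 2) * (\<sigma> / (s + \<sigma>)) powr \<rho> * (k s - k0))"
        unfolding p_def by (simp add: algebra_simps)
      also have "\<dots> \<le> p s * k s - k0 * p s + \<epsilon> * (1 - \<alpha>) * (\<sigma> powr \<rho> / (c + \<sigma>) * b s)"
        using kernel_increment_bound[OF \<alpha> \<sigma> \<rho> s'] \<alpha> \<epsilon> unfolding k_def k0_def b_def
        by (intro add_left_mono mult_left_mono) auto
      also have "\<dots> = q s" by (simp add: q_def D_def)
      finally show ?thesis .
    qed
    have k_cell: "(k has_integral (?b - ?a) * wt m j) {?a..?b}"
    proof -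
      have "(?b - ?a) * wt m j = integral {?a..?b} k"
        using wt_integral[of j m] j m unfolding k_def[abs_def] c_def by auto
      moreover have "k integrable_on {?a..?b}"
        using kernel_has_integral[of \<alpha> ?a ?b c] \<alpha> ab unfolding k_def[abs_def] by (auto intro!: has_integral_integrable)
      ultimately show ?thesis by (simp add: integrable_integral)
    qed
    have "((\<lambda>s. k0) has_integral (?b - ?a) * k0) {?a..?b}"
      using has_integral_const_real[of k0 ?a ?b] ab by simp
    from has_integral_mult_right[OF has_integral_diff[OF k_cell this], of d]
    have "((\<lambda>s. d * (k s - k0)) has_integral d * ((?b - ?a) * wt m j - (?b - ?a) * k0)) {?a..?b}" .
    moreover have "q integrable_on {?a..?b}"
      by (rule integrable_on_subinterval[OF has_integral_integrable[OF q_int]]) (use ab in auto)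
    ultimately have "d * ((?b - ?a) * wt m j - (?b - ?a) * k0) \<le> integral {?a..?b} q"
      using pw by (intro has_integral_le[OF _ integrable_integral]) auto
    moreover have "d * ((?b - ?a) * wt m j - (?b - ?a) * k0) = (v ?a - v ?b) * (wt m j - k0)"
      unfolding d_def using ab by (simp add: field_simps)
    ultimately show ?thesis by simp
  qed
  have "(\<Sum>j=1..m. (v (t (j - 1)) - v (t j)) * (wt m j - k0)) \<le> (\<Sum>j=1..m. integral {t (j - 1)..t j} q)"
    by (intro sum_mono cell)
  also have "\<dots> = integral {0..c} q"
    using integral_sum_cells[of m q] has_integral_integrable[OF q_int] m unfolding c_def by blast
  also have "\<dots> = (c / \<sigma>) powr (1 - \<alpha>) / (c + \<sigma>) - k0 * (v 0 - v c)
      + D * (c powr (- \<rho>) * Beta (\<alpha> - \<rho>) (1 - \<alpha>))"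
    using q_int by (rule integral_unique)
  finally have 1: "(\<Sum>j=1..m. (v (t (j - 1)) - v (t j)) * (wt m j - k0)) \<le> \<dots>" .
  \<comment> \<open>The increments telescope, so subtracting \<open>k0\<close> from all weights
    costs \<open>k0 * (v c - v 0)\<close>, which cancels against the same correction in the integral
    of q.\<close>
  have "(\<Sum>j=1..m. v (t j) - v (t (j - 1))) = v c - v 0"
    using sum_telescope''[of 0 m "\<lambda>j. v (t j)"] by (simp add: t_0 c_def)
  moreover have "L1_sum (\<lambda>i. v (t i)) m + (\<Sum>j=1..m. (v (t (j - 1)) - v (t j)) * (wt m j - k0))
      = (\<Sum>j=1..m. k0 * (v (t j) - v (t (j - 1))))"
    unfolding L1_sum_def sum.distrib[symmetric] by (intro sum.cong) (auto simp: algebra_simps)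
  ultimately have "L1_sum (\<lambda>i. v (t i)) m + (\<Sum>j=1..m. (v (t (j - 1)) - v (t j)) * (wt m j - k0)) = k0 * (v c - v 0)"
    by (simp only: sum_distrib_left[symmetric])
  with 1 have "L1_sum (\<lambda>i. v (t i)) m \<ge> k0 * (v c - v 0) - ((c / \<sigma>) powr (1 - \<alpha>) / (c + \<sigma>) - k0 * (v 0 - v c)
      + D * (c powr (- \<rho>) * Beta (\<alpha> - \<rho>) (1 - \<alpha>)))"
    by linarith
  moreover have "L1_sum (\<lambda>i. if i = 0 then 0 else v (t i)) m = L1_sum (\<lambda>i. v (t i)) m + v 0 * wt m 1"
    using L1_sum_zero_start[of m "\<lambda>i. v (t i)"] m by (simp add: t_0)
  moreover have "v 0 * k0 \<le> v 0 * wt m 1"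
    using wt_ge[of 1 m] m by (intro mult_left_mono) (auto simp: k0_def c_def t_0 v_def)
  ultimately have 2: "v 0 * k0 - (c / \<sigma>) powr (1 - \<alpha>) / (c + \<sigma>) - D * (c powr (- \<rho>) * Beta (\<alpha> - \<rho>) (1 - \<alpha>))
      \<le> L1_sum (\<lambda>i. if i = 0 then 0 else v (t i)) m"
    by (simp add: algebra_simps)
  \<comment> \<open>The jump term minus the exact kernel integral of \<open>p\<close> leaves
    precisely the residual of the continuous problem.\<close>
  have "v 0 * k0 = (\<sigma> / c) powr \<alpha> / \<sigma>"
    using \<sigma> c by (simp add: v_def k0_def powr_diff powr_divide powr_minus_divide)
  moreover have "(c / \<sigma>) powr (1 - \<alpha>) = (\<sigma> / c) powr \<alpha> * c / \<sigma>"
    using \<sigma> c by (simp add: powr_diff powr_divide mult_ac)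
  moreover have "X / \<sigma> - X * c / \<sigma> / (c + \<sigma>) = X / (c + \<sigma>)" for X
  proof -
    have "X / \<sigma> - X * c / \<sigma> / (c + \<sigma>) = (X * (c + \<sigma>) - X * c) / (\<sigma> * (c + \<sigma>))"
      using \<sigma> c by (simp add: diff_divide_distrib)
    also have "X * (c + \<sigma>) - X * c = \<sigma> * X" by (simp add: algebra_simps)
    finally show ?thesis using \<sigma> by simp
  qed
  ultimately have 3: "v 0 * k0 - (c / \<sigma>) powr (1 - \<alpha>) / (c + \<sigma>) = (\<sigma> / c) powr \<alpha> / (c + \<sigma>)"
    by metis
  have 4: "D * (c powr (- \<rho>) * Beta (\<alpha> - \<rho>) (1 - \<alpha>)) =
      \<epsilon> * (1 - \<alpha>) * Beta (\<alpha> - \<rho>) (1 - \<alpha>) * (\<sigma> / c) powr \<rho> / (c + \<sigma>)"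
    using \<sigma> c by (simp add: D_def powr_divide powr_minus_divide mult_ac)
  from 2[unfolded 3 4] show ?thesis
    unfolding v_def c_def by (simp add: diff_divide_distrib)
qed

end

section \<open>Dyadic sums\<close>

lemma two_powr_minus_less_one: "0 < a \<Longrightarrow> 2 powr (- a) < (1 :: real)"
  using powr_less_mono[of "- a" 0 2] by simp

lemma dyadic_sum_le:
  fixes a x :: real
  assumes "0 < a" "0 < x"
  shows "(\<Sum>k<n. (2 ^ k * x) powr a) \<le> (2 ^ n * x) powr a / (2 powr a - 1)"
proof (induction n)
  case (Suc n)
  have "2 powr a > 1" using assms by simp
  moreover have "(2 ^ Suc n * x) powr a = 2 powr a * (2 ^ n * x) powr a"
    using assms by (simp add: powr_mult mult.assoc)
  ultimately show ?case using Suc by (simp add: field_simps)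
next
  case 0
  have "1 \<le> 2 powr a" using assms by (intro ge_one_powr_ge_zero) auto
  then show ?case by simp
qed

lemma dyadic_tail_sum_le:
  fixes a x :: real
  assumes "0 < a" "0 < x"
  shows "(\<Sum>k=n..<N. (2 ^ k * x) powr (- a)) \<le> (2 ^ n * x) powr (- a) / (1 - 2 powr (- a))"
proof (cases "n \<le> N")
  case True
  have less: "2 powr (- a) < (1 :: real)" using assms two_powr_minus_less_one by simp
  have "(\<Sum>k=n..<N. (2 ^ k * x) powr (- a)) =
      ((2 ^ n * x) powr (- a) - (2 ^ N * x) powr (- a)) / (1 - 2 powr (- a))"
    using True
  proof (induction N rule: dec_induct)
    case (step N)
    have "(2 ^ Suc N * x) powr (- a) = 2 powr (- a) * (2 ^ N * x) powr (- a)"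
      using assms by (simp add: powr_mult mult.assoc)
    moreover have "B + (A - B) / (1 - r) = (A - r * B) / (1 - r)" if "r < 1" for A B r :: real
      using that by (simp add: add_divide_eq_iff algebra_simps)
    ultimately show ?case using step less by (simp add: add.commute)
  qed simp
  also have "\<dots> \<le> (2 ^ n * x) powr (- a) / (1 - 2 powr (- a))"
    using less by (intro divide_right_mono) auto
  finally show ?thesis .
next
  case False
  then show ?thesis using assms two_powr_minus_less_one[of a] by simp
qed

text \<open>In the applications x is the ratio of the smallest scale to a time s, so
  \<open>2 ^ k * x\<close> is the ratio of the k-th scale to s, and n is the first scale not below
  s. All sums are split there; \<open>n = 0\<close> occurs when even the smallest scale reaches
  s.\<close>

lemma dyadic_threshold:
  fixes x :: real
  assumes "1 \<le> 2 ^ (N - 1) * x" "1 \<le> N"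
  obtains n where "n < N" "1 \<le> 2 ^ n * x" "\<And>k. k < n \<Longrightarrow> 2 ^ k * x < 1" "n = 0 \<or> 2 ^ n * x < 2"
proof -
  define n where "n = (LEAST n. 1 \<le> 2 ^ n * x)"
  have 1: "1 \<le> 2 ^ n * x" unfolding n_def using assms(1) by (rule LeastI)
  have 2: "2 ^ k * x < 1" if "k < n" for k using not_less_Least that unfolding n_def by fastforce
  have "n \<le> N - 1" unfolding n_def using assms(1) by (rule Least_le)
  moreover have "n = 0 \<or> 2 ^ n * x < 2"
  proof (cases n)
    case (Suc k)
    then show ?thesis using 2[of k] by simp
  qed simp
  ultimately show ?thesis using that[of n] 1 2 assms(2) by auto
qed

text \<open>The threshold scale alone contributes a quarter of
  \<open>X n powr (\<alpha> - \<gamma> - 1)\<close>. Larger scales are nonnegative because \<rho>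
  \<le> \<alpha> and \<open>E \<le> 1 / 2\<close>. For smaller scales only the error is kept; since
  \<gamma> < \<rho> it sums geometrically to at most half of the threshold contribution. The power
  of K covers the case where the smallest scale already lies above s.\<close>

lemma dyadic_lower_bound:
  fixes \<alpha> \<gamma> \<rho> x E K :: real
  assumes par: "\<rho> \<le> \<alpha>" "\<alpha> - 1 < \<gamma>" "\<gamma> < \<rho>" and x: "0 < x" "x \<le> K" and K: "2 \<le> K"
    and N: "1 \<le> 2 ^ (N - 1) * x" "1 \<le> N"
    and E: "0 \<le> E" "E \<le> 1 / 2" "E \<le> 2 powr (\<alpha> - \<gamma> - 1) * (1 - 2 powr (\<gamma> - \<rho>)) / 8"
  shows "K powr (\<alpha> - \<gamma> - 1) / 8 \<le>
    (\<Sum>k<N. ((2 ^ k * x) powr (\<alpha> - \<gamma>) - E * (2 ^ k * x) powr (\<rho> - \<gamma>)) / (1 + 2 ^ k * x))"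
proof -
  define X where "X k = 2 ^ k * x" for k
  define f where "f k = (X k powr (\<alpha> - \<gamma>) - E * X k powr (\<rho> - \<gamma>)) / (1 + X k)" for k
  obtain n where n: "n < N" "1 \<le> X n" "\<And>k. k < n \<Longrightarrow> X k < 1" "n = 0 \<or> X n < 2"
    using dyadic_threshold[OF N] unfolding X_def by blast
  have X_pos: "0 < X k" for k using x by (simp add: X_def)
  have X_mono: "X n \<le> X k" if "n \<le> k" for k using that x by (simp add: X_def)
  have big: "X k powr (\<alpha> - \<gamma>) / 2 / (1 + X k) \<le> f k" if "n \<le> k" for k
  proof -
    have "X k powr (\<rho> - \<gamma>) \<le> X k powr (\<alpha> - \<gamma>)"
      using n(2) X_mono[OF that] par by (intro powr_mono) auto
    then have "E * X k powr (\<rho> - \<gamma>) \<le> 1 / 2 * X k powr (\<alpha> - \<gamma>)"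
      using E by (intro mult_mono) auto
    then show ?thesis unfolding f_def using X_pos[of k] by (intro divide_right_mono) auto
  qed
  have "X n powr (\<alpha> - \<gamma> - 1) / 4 = X n powr (\<alpha> - \<gamma>) / 2 / (2 * X n)"
    using X_pos[of n] by (simp add: powr_diff)
  also have "\<dots> \<le> X n powr (\<alpha> - \<gamma>) / 2 / (1 + X n)"
    using n(2) by (intro divide_left_mono) auto
  also have "\<dots> \<le> f n" by (rule big) simp
  finally have fn: "X n powr (\<alpha> - \<gamma> - 1) / 4 \<le> f n" .
  have "0 \<le> f k" if "n \<le> k" for k
    using big[OF that] X_pos[of k] by (rule_tac order_trans[OF _ big[OF that]]) auto
  then have "f n \<le> (\<Sum>k=n..<N. f k)"
    using n(1) by (intro member_le_sum) auto
  moreover have "(\<Sum>k<N. f k) = (\<Sum>k<n. f k) + (\<Sum>k=n..<N. f k)"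
    using n(1) by (simp add: lessThan_atLeast0 sum.atLeastLessThan_concat)
  ultimately have split: "(\<Sum>k<n. f k) + X n powr (\<alpha> - \<gamma> - 1) / 4 \<le> (\<Sum>k<N. f k)"
    using fn by linarith
  have "K powr (\<alpha> - \<gamma> - 1) / 8 \<le> (\<Sum>k<N. f k)"
  proof (cases "n = 0")
    case True
    then have "K powr (\<alpha> - \<gamma> - 1) \<le> X n powr (\<alpha> - \<gamma> - 1)"
      using par x by (intro powr_mono2') (auto simp: X_def)
    moreover have "0 \<le> K powr (\<alpha> - \<gamma> - 1)" by simp
    moreover have "X n powr (\<alpha> - \<gamma> - 1) / 4 \<le> (\<Sum>k<N. f k)" using split True by simp
    ultimately show ?thesis by linarith
  next
    case False
    then have Xn: "X n < 2" using n by auto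
    have "- E * X k powr (\<rho> - \<gamma>) \<le> f k" for k
    proof -
      have "E * X k powr (\<rho> - \<gamma>) / (1 + X k) \<le> E * X k powr (\<rho> - \<gamma>)"
        using E X_pos[of k] by (simp add: divide_le_eq mult_left_mono mult_nonneg_nonneg algebra_simps)
      moreover have "0 \<le> X k powr (\<alpha> - \<gamma>) / (1 + X k)" using X_pos[of k] by simp
      ultimately show ?thesis unfolding f_def diff_divide_distrib by linarith
    qed
    then have "(\<Sum>k<n. - E * X k powr (\<rho> - \<gamma>)) \<le> (\<Sum>k<n. f k)"
      by (intro sum_mono)
    moreover have "(\<Sum>k<n. - E * X k powr (\<rho> - \<gamma>)) = - (E * (\<Sum>k<n. X k powr (\<rho> - \<gamma>)))"
      by (simp add: sum_distrib_left sum_negf)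
    \<comment> \<open>The third hypothesis on E is tuned to this estimate: with
      \<open>r = 2 powr (\<rho> - \<gamma>)\<close> its factor 1 - 1 / r cancels r / (r - 1), the
      value of the geometric series up to the threshold.\<close>
    moreover have "E * (\<Sum>k<n. X k powr (\<rho> - \<gamma>)) \<le> 2 powr (\<alpha> - \<gamma> - 1) / 8"
    proof -
      define r where "r = (2 :: real) powr (\<rho> - \<gamma>)"
      have r: "1 < r" using par by (simp add: r_def)
      have "(\<Sum>k<n. X k powr (\<rho> - \<gamma>)) \<le> X n powr (\<rho> - \<gamma>) / (r - 1)"
        using dyadic_sum_le[of "\<rho> - \<gamma>" x n] par x by (simp add: X_def r_def)
      also have "X n powr (\<rho> - \<gamma>) \<le> r"
        unfolding r_def using par Xn X_pos[of n] by (intro powr_mono2) auto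
      finally have "(\<Sum>k<n. X k powr (\<rho> - \<gamma>)) \<le> r / (r - 1)"
        using r by (simp add: divide_right_mono)
      then have "E * (\<Sum>k<n. X k powr (\<rho> - \<gamma>)) \<le>
          (2 powr (\<alpha> - \<gamma> - 1) * (1 - 2 powr (\<gamma> - \<rho>)) / 8) * (r / (r - 1))"
        using E r by (intro mult_mono) (auto intro: sum_nonneg)
      also have "2 powr (\<gamma> - \<rho>) = 1 / r"
        unfolding r_def using powr_minus_divide[of 2 "\<rho> - \<gamma>"] by simp
      also have "(2 powr (\<alpha> - \<gamma> - 1) * (1 - 1 / r) / 8) * (r / (r - 1)) = 2 powr (\<alpha> - \<gamma> - 1) / 8"
        using r by (simp add: field_simps)
      finally show ?thesis .
    qed
    moreover have "2 powr (\<alpha> - \<gamma> - 1) \<le> X n powr (\<alpha> - \<gamma> - 1)"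
      using par Xn X_pos[of n] by (intro powr_mono2') auto
    moreover have "K powr (\<alpha> - \<gamma> - 1) \<le> 2 powr (\<alpha> - \<gamma> - 1)"
      using par K by (intro powr_mono2') auto
    ultimately show ?thesis using split by linarith
  qed
  then show ?thesis unfolding f_def X_def .
qed

text \<open>Here y stands for s / \<tau>. Scales above s decay geometrically as \<gamma> > \<alpha>
  - 1. Below s the terms are at most \<open>X k powr (- \<gamma>)\<close>: the sum is governed by
  its last term for \<gamma> < 0, by its first for \<gamma> > 0, and counts the scales for \<gamma>
  = 0. This is the origin of \<open>max 0 \<gamma>\<close> and of the logarithm.\<close>

lemma dyadic_upper_bound:
  fixes \<alpha> \<gamma> :: real
  assumes par: "\<alpha> < 1" "\<alpha> - 1 < \<gamma>"
  obtains C where "0 < C"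
    "\<And>x y N. 0 < x \<Longrightarrow> 1 \<le> y \<Longrightarrow> 1 \<le> x * y \<Longrightarrow> 1 \<le> N \<Longrightarrow> 1 \<le> 2 ^ (N - 1) * x \<Longrightarrow>
      (\<Sum>k<N. (2 ^ k * x) powr (- \<gamma>) * (1 + 2 ^ k * x) powr (\<alpha> - 1)) \<le>
      C * (y powr (max 0 \<gamma>) * log_factor \<gamma> 1 y)"
proof -
  define C1 where "C1 = (if \<gamma> < 0 then 2 powr (- \<gamma>) / (2 powr (- \<gamma>) - 1)
    else if \<gamma> = 0 then 2 else 1 / (1 - 2 powr (- \<gamma>)))"
  define C2 where "C2 = 1 / (1 - 2 powr (- (1 + \<gamma> - \<alpha>)))"
  have C1: "0 < C1" using two_powr_minus_less_one[of \<gamma>] by (auto simp: C1_def)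
  have C2: "0 < C2" using par two_powr_minus_less_one[of "1 + \<gamma> - \<alpha>"] by (simp add: C2_def)
  show ?thesis
  proof (rule that[of "C1 + C2"])
    fix x y :: real and N :: nat
    assume x: "0 < x" and y: "1 \<le> y" and xy: "1 \<le> x * y" and N: "1 \<le> N" "1 \<le> 2 ^ (N - 1) * x"
    define X where "X k = 2 ^ k * x" for k
    obtain n where n: "n < N" "1 \<le> X n" "\<And>k. k < n \<Longrightarrow> X k < 1" "n = 0 \<or> X n < 2"
      using dyadic_threshold[OF N(2,1)] unfolding X_def by blast
    have X_pos: "0 < X k" for k using x by (simp add: X_def)
    define Y where "Y = y powr (max 0 \<gamma>) * log_factor \<gamma> 1 y"
    have ln: "0 \<le> ln y" using y by simp
    have "1 \<le> y powr (max 0 \<gamma>)" using y by (simp add: ge_one_powr_ge_zero)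
    moreover have "1 \<le> log_factor \<gamma> 1 y" using ln by (simp add: log_factor_def)
    ultimately have Y: "1 \<le> Y" unfolding Y_def
      using mult_mono[of 1 "y powr (max 0 \<gamma>)" 1 "log_factor \<gamma> 1 y"] by simp
    have "(\<Sum>k<n. X k powr (- \<gamma>) * (1 + X k) powr (\<alpha> - 1)) \<le> (\<Sum>k<n. X k powr (- \<gamma>) * 1)"
    proof (intro sum_mono mult_left_mono)
      fix k
      have "(1 + X k) powr (\<alpha> - 1) \<le> 1 powr (\<alpha> - 1)"
        using X_pos[of k] par by (intro powr_mono2') auto
      then show "(1 + X k) powr (\<alpha> - 1) \<le> 1" by simp
    qed auto
    also have "\<dots> \<le> C1 * Y"
    proof (cases "\<gamma> = 0")
      case True
      \<comment> \<open>The last scale below s has index n - 1, so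
        \<open>2 ^ (n - 1) \<le> y\<close>; the 2 comes from
        \<open>ln 2 \<ge> 1 / 2\<close>.\<close>
      have "real n \<le> 2 * (1 + ln y)"
      proof (cases n)
        case (Suc k)
        then have "2 ^ k * x < 1" using n(3)[of k] by (simp add: X_def)
        then have "2 ^ k * x \<le> x * y" using xy by simp
        then have "2 ^ k \<le> y" using x by (simp add: mult.commute)
        then have "ln (2 ^ k) \<le> ln y" using y by (subst ln_le_cancel_iff) auto
        then have "real k * ln 2 \<le> ln y" by (simp add: ln_realpow)
        moreover have "real k * (1 / 2) \<le> real k * ln 2"
          using ln2_ge_two_thirds by (intro mult_left_mono) auto
        ultimately show ?thesis using Suc by simp
      qed (use ln in simp)
      then show ?thesis using True y X_pos by (simp add: C1_def Y_def log_factor_def less_imp_neq[symmetric])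
    next
      case False
      show ?thesis
      proof (cases "\<gamma> < 0")
        case True
        define r where "r = (2 :: real) powr (- \<gamma>)"
        have r: "1 < r" using True by (simp add: r_def)
        have "(\<Sum>k<n. X k powr (- \<gamma>)) \<le> C1"
        proof (cases "n = 0")
          case False
          have "(\<Sum>k<n. X k powr (- \<gamma>)) \<le> X n powr (- \<gamma>) / (r - 1)"
            using dyadic_sum_le[of "- \<gamma>" x n] True x by (simp add: X_def r_def)
          also have "X n powr (- \<gamma>) \<le> r"
            using False True n(4) X_pos[of n] unfolding r_def by (intro powr_mono2) auto
          finally have "(\<Sum>k<n. X k powr (- \<gamma>)) \<le> r / (r - 1)"
            using r by (simp add: divide_right_mono)
          then show ?thesis using True by (simp add: C1_def r_def)
        qed (use C1 in simp)
        also have "\<dots> \<le> C1 * Y" using C1 Y by simp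
        finally show ?thesis by simp
      next
        case False
        then have g: "\<gamma> > 0" using \<open>\<gamma> \<noteq> 0\<close> by simp
        have "(\<Sum>k<n. X k powr (- \<gamma>)) \<le> x powr (- \<gamma>) / (1 - 2 powr (- \<gamma>))"
          using dyadic_tail_sum_le[of \<gamma> x 0 n] g x by (simp add: X_def lessThan_atLeast0)
        also have "x powr (- \<gamma>) \<le> (1 / y) powr (- \<gamma>)"
          using xy x y g by (intro powr_mono2') (auto simp: field_simps)
        also have "(1 / y) powr (- \<gamma>) = y powr \<gamma>"
          using y by (simp add: powr_minus_divide powr_divide)
        finally show ?thesis using g two_powr_minus_less_one[of \<gamma>]
          by (simp add: C1_def Y_def log_factor_def divide_right_mono)
      qed
    qed
    finally have low: "(\<Sum>k<n. X k powr (- \<gamma>) * (1 + X k) powr (\<alpha> - 1)) \<le> C1 * Y" .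
    have "(\<Sum>k=n..<N. X k powr (- \<gamma>) * (1 + X k) powr (\<alpha> - 1)) \<le> (\<Sum>k=n..<N. X k powr (- (1 + \<gamma> - \<alpha>)))"
    proof (intro sum_mono)
      fix k
      have "(1 + X k) powr (\<alpha> - 1) \<le> X k powr (\<alpha> - 1)"
        using X_pos[of k] par by (intro powr_mono2') auto
      then have "X k powr (- \<gamma>) * (1 + X k) powr (\<alpha> - 1) \<le> X k powr (- \<gamma>) * X k powr (\<alpha> - 1)"
        by (intro mult_left_mono) auto
      also have "\<dots> = X k powr (- (1 + \<gamma> - \<alpha>))" by (simp add: powr_add[symmetric] algebra_simps)
      finally show "X k powr (- \<gamma>) * (1 + X k) powr (\<alpha> - 1) \<le> X k powr (- (1 + \<gamma> - \<alpha>))" .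
    qed
    also have "\<dots> \<le> X n powr (- (1 + \<gamma> - \<alpha>)) / (1 - 2 powr (- (1 + \<gamma> - \<alpha>)))"
      unfolding X_def using dyadic_tail_sum_le[of "1 + \<gamma> - \<alpha>" x n N] par x by simp
    also have "\<dots> \<le> C2"
      unfolding C2_def using n(2) par powr_mono2'[of "- (1 + \<gamma> - \<alpha>)" 1 "X n"]
        less_imp_le[OF two_powr_minus_less_one[of "1 + \<gamma> - \<alpha>"]]
      by (intro divide_right_mono) auto
    also have "\<dots> \<le> C2 * Y" using C2 Y by simp
    finally have "(\<Sum>k=n..<N. X k powr (- \<gamma>) * (1 + X k) powr (\<alpha> - 1)) \<le> C2 * Y" .
    moreover have "(\<Sum>k<N. X k powr (- \<gamma>) * (1 + X k) powr (\<alpha> - 1)) =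
        (\<Sum>k<n. X k powr (- \<gamma>) * (1 + X k) powr (\<alpha> - 1)) + (\<Sum>k=n..<N. X k powr (- \<gamma>) * (1 + X k) powr (\<alpha> - 1))"
      using n(1) by (simp add: lessThan_atLeast0 sum.atLeastLessThan_concat)
    ultimately show "(\<Sum>k<N. (2 ^ k * x) powr (- \<gamma>) * (1 + 2 ^ k * x) powr (\<alpha> - 1)) \<le>
        (C1 + C2) * (y powr (max 0 \<gamma>) * log_factor \<gamma> 1 y)"
      using low unfolding X_def Y_def by (simp add: distrib_right)
  qed (use C1 C2 in simp)
qed

section \<open>Superposition over dyadic scales\<close>

context L1_mesh
begin

lemma L1_sum_linear:
  "L1_sum (\<lambda>i. \<Sum>k\<in>A. c k * F k i) m = (\<Sum>k\<in>A. c k * L1_sum (F k) m)"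
proof -
  have "L1_sum (\<lambda>i. \<Sum>k\<in>A. c k * F k i) m = (\<Sum>j=1..m. \<Sum>k\<in>A. c k * ((F k j - F k (j - 1)) * wt m j))"
    unfolding L1_sum_def
  proof (intro sum.cong refl)
    fix j
    show "((\<Sum>k\<in>A. c k * F k j) - (\<Sum>k\<in>A. c k * F k (j - 1))) * wt m j =
        (\<Sum>k\<in>A. c k * ((F k j - F k (j - 1)) * wt m j))"
      unfolding sum_subtractf[symmetric] sum_distrib_right by (intro sum.cong) (auto simp: algebra_simps)
  qed
  also have "\<dots> = (\<Sum>k\<in>A. \<Sum>j=1..m. c k * ((F k j - F k (j - 1)) * wt m j))"
    by (rule sum.swap)
  finally show ?thesis unfolding L1_sum_def by (simp add: sum_distrib_left)
qed

lemma L1_sum_cmult: "L1_sum (\<lambda>i. c * F i) m = c * L1_sum F m"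
  using L1_sum_linear[of "\<lambda>_. c" "\<lambda>_. F" "{()}" m] by simp

lemma L1_sum_add: "L1_sum (\<lambda>i. F i + G i) m = L1_sum F m + L1_sum G m"
  unfolding L1_sum_def sum.distrib[symmetric] by (intro sum.cong) (auto simp: algebra_simps)

text \<open>The factor 2 accounts for the delayed argument in \<open>lam1 * B (j - 1)\<close>: the power-type barriers
  decrease, but at most by a factor 2 per step.\<close>

lemma le_barrier:
  assumes diag: "\<And>j. j \<in> {1..n} \<Longrightarrow> lam0 * mesh_step t j powr \<alpha> < 1 / Gamma (2 - \<alpha>)"
    and lam1: "0 \<le> lam1" and n: "n \<le> M" and init: "U 0 = 0" "B 0 = 0"
    and halving: "\<And>j. j \<in> {1..n} \<Longrightarrow> B (j - 1) \<le> 2 * B j"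
    and U: "\<And>j. j \<in> {1..n} \<Longrightarrow> L1_op \<alpha> t U j - lam0 * U j - lam1 * U (j - 1) \<le> f j"
    and B: "\<And>j. j \<in> {1..n} \<Longrightarrow> Gamma (1 - \<alpha>) * f j \<le> L1_sum B j - Gamma (1 - \<alpha>) * (lam0 + 2 * lam1) * B j"
  shows "U n \<le> B n"
proof (rule comparison[OF diag lam1 n, where U = U and B = B])
  fix j assume j: "j \<in> {1..n}"
  have G: "Gamma (1 - \<alpha>) > 0" using \<alpha> by (auto intro: Gamma_real_pos)
  have "Gamma (1 - \<alpha>) * (f j + (lam0 + 2 * lam1) * B j) \<le> L1_sum B j"
    using B[OF j] by (simp add: algebra_simps)
  then have "f j + (lam0 + 2 * lam1) * B j \<le> L1_op \<alpha> t B j"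
    unfolding L1_op_eq using G by (simp add: pos_le_divide_eq mult.commute)
  moreover have "lam1 * B (j - 1) \<le> lam1 * (2 * B j)"
    using halving[OF j] lam1 by (rule mult_left_mono)
  ultimately show "L1_op \<alpha> t U j - lam0 * U j - lam1 * U (j - 1) \<le> L1_op \<alpha> t B j - lam0 * B j - lam1 * B (j - 1)"
    using U[OF j] by (simp add: algebra_simps)
qed (use init in auto)

definition exp_seq :: "real \<Rightarrow> nat \<Rightarrow> real" where
  "exp_seq \<mu> i = (if i = 0 then 0 else exp (\<mu> * t i))"

lemma exp_seq_halving:
  assumes "0 \<le> \<mu>" "j \<in> {1..M}"
  shows "exp_seq \<mu> (j - 1) \<le> 2 * exp_seq \<mu> j"
proof -
  have "\<mu> * t (j - 1) \<le> \<mu> * t j" using assms t_step[of j] by (intro mult_left_mono) auto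
  then have "exp (\<mu> * t (j - 1)) \<le> 1 * exp (\<mu> * t j)" by simp
  also have "\<dots> \<le> 2 * exp (\<mu> * t j)" by (intro mult_right_mono) auto
  finally show ?thesis using assms unfolding exp_seq_def by auto
qed

text \<open>For \<gamma> \<le> \<alpha> - 1 the load is a constant times
  \<open>s powr (- \<alpha>)\<close> times the nondecreasing function
  \<open>s powr (\<alpha> - 1 - \<gamma>)\<close>. Up to time \<open>t n\<close> it is thus at most
  a multiple of \<open>s powr (- \<alpha>)\<close>, which the exponential barrier dominates without
  any grading.\<close>

lemma stability_regular:
  assumes diag: "\<And>j. j \<in> {1..M} \<Longrightarrow> lam0 * mesh_step t j powr \<alpha> < 1 / Gamma (2 - \<alpha>)"
    and lam: "0 \<le> lam0" "0 \<le> lam1"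
    and \<mu>: "0 < \<mu>" "6 * (Gamma (1 - \<alpha>) * (lam0 + 2 * lam1)) \<le> \<mu> powr \<alpha>"
    and step: "\<And>j. j \<in> {1..M} \<Longrightarrow> mesh_step t j \<le> 1 / \<mu>"
    and \<gamma>: "\<gamma> \<le> \<alpha> - 1" and C0: "0 \<le> C0" and U0: "U 0 = 0"
    and U: "\<And>j. j \<in> {1..M} \<Longrightarrow> L1_op \<alpha> t U j - lam0 * U j - lam1 * U (j - 1) \<le> C0 * (t 1 / t j) powr (\<gamma> + 1)"
    and n: "1 \<le> n" "n \<le> M"
  shows "U n \<le> 2 * C0 * Gamma (1 - \<alpha>) * exp (\<mu> * t n) * t 1 * t n powr (\<alpha> - 1) * (t 1 / t n) powr \<gamma>"
proof -
  \<comment> \<open>The nondecreasing factor is frozen at the target node \<open>t n\<close>; the 2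
    undoes the 1 / 2 in the exponential barrier.\<close>
  define \<kappa> where "\<kappa> = 2 * C0 * Gamma (1 - \<alpha>) * t 1 powr (\<gamma> + 1) * t n powr (\<alpha> - 1 - \<gamma>)"
  have G: "Gamma (1 - \<alpha>) > 0" using \<alpha> by (auto intro: Gamma_real_pos)
  have \<kappa>: "0 \<le> \<kappa>" using C0 G by (simp add: \<kappa>_def)
  have t1: "0 < t 1" and tn: "0 < t n" using t_pos n by auto
  have "U n \<le> \<kappa> * exp_seq \<mu> n"
  proof (rule le_barrier[where U = U and B = "\<lambda>i. \<kappa> * exp_seq \<mu> i" and n = n])
    fix j assume j: "j \<in> {1..n}"
    then have j': "j \<in> {1..M}" "1 \<le> j" "j \<le> M" using n by auto
    have tj: "0 < t j" "t j \<le> t n" using t_pos t_mono[of j n] j n by auto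
    show "lam0 * mesh_step t j powr \<alpha> < 1 / Gamma (2 - \<alpha>)" using diag j' by simp
    show "\<kappa> * exp_seq \<mu> (j - 1) \<le> 2 * (\<kappa> * exp_seq \<mu> j)"
      using mult_left_mono[OF exp_seq_halving[of \<mu> j] \<kappa>] \<mu> j' by simp
    show "L1_op \<alpha> t U j - lam0 * U j - lam1 * U (j - 1) \<le> C0 * (t 1 / t j) powr (\<gamma> + 1)"
      using U j' by simp
    have "(t 1 / t j) powr (\<gamma> + 1) = t 1 powr (\<gamma> + 1) * (t j powr (\<alpha> - 1 - \<gamma>) * t j powr (- \<alpha>))"
    proof -
      have "t j powr (\<alpha> - 1 - \<gamma>) * t j powr (- \<alpha>) = t j powr (- (\<gamma> + 1))"
        by (subst powr_add[symmetric]) (simp add: algebra_simps)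
      then show ?thesis using t1 tj powr_minus_divide[of "t j" "\<gamma> + 1"] by (simp add: powr_divide)
    qed
    also have "\<dots> \<le> t 1 powr (\<gamma> + 1) * (t n powr (\<alpha> - 1 - \<gamma>) * t j powr (- \<alpha>))"
      using tj \<gamma> by (intro mult_left_mono mult_right_mono powr_mono2) auto
    finally have "C0 * Gamma (1 - \<alpha>) * (t 1 / t j) powr (\<gamma> + 1) \<le>
        C0 * Gamma (1 - \<alpha>) * (t 1 powr (\<gamma> + 1) * (t n powr (\<alpha> - 1 - \<gamma>) * t j powr (- \<alpha>)))"
      using C0 G by (intro mult_left_mono) auto
    also have "\<dots> = \<kappa> * (t j powr (- \<alpha>) / 2)" by (simp add: \<kappa>_def)
    also have "\<dots> \<le> \<kappa> * (L1_sum (exp_seq \<mu>) j - Gamma (1 - \<alpha>) * (lam0 + 2 * lam1) * exp_seq \<mu> j)"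
      using exp_barrier[of j \<mu> "Gamma (1 - \<alpha>) * (lam0 + 2 * lam1)"] step G lam \<mu> j' \<kappa>
      unfolding exp_seq_def[abs_def] by (intro mult_left_mono) auto
    finally show "Gamma (1 - \<alpha>) * (C0 * (t 1 / t j) powr (\<gamma> + 1)) \<le>
        L1_sum (\<lambda>i. \<kappa> * exp_seq \<mu> i) j - Gamma (1 - \<alpha>) * (lam0 + 2 * lam1) * (\<kappa> * exp_seq \<mu> j)"
      unfolding L1_sum_cmult by (simp add: algebra_simps)
  qed (use lam n U0 in \<open>auto simp: exp_seq_def\<close>)
  moreover have "t 1 powr (\<gamma> + 1) * t n powr (\<alpha> - 1 - \<gamma>) = t 1 * t n powr (\<alpha> - 1) * (t 1 / t n) powr \<gamma>"
    using t1 tn by (simp add: powr_divide powr_add powr_diff)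
  ultimately show ?thesis using n unfolding \<kappa>_def exp_seq_def by (simp add: mult_ac)
qed

section \<open>Dyadic sums of shifted powers on a mesh\<close>

definition power_sum :: "real \<Rightarrow> real \<Rightarrow> nat \<Rightarrow> nat \<Rightarrow> real" where
  "power_sum \<gamma> \<sigma> N i =
    (if i = 0 then 0 else \<Sum>k<N. (2 ^ k * \<sigma>) powr (- \<gamma>) * (t i + 2 ^ k * \<sigma>) powr (\<alpha> - 1))"

lemma power_sum_nonneg: "0 \<le> power_sum \<gamma> \<sigma> N i"
  unfolding power_sum_def by (auto intro!: sum_nonneg)

text \<open>Measuring all scales in units of \<open>t m\<close> pulls out
  \<open>t m powr (- 1 - \<gamma>)\<close> and leaves the dimensionless sum of
  \<open>dyadic_lower_bound\<close>. Its ratio x is at most K because \<open>t 1 \<le> t m\<close>,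
  and the condition on N says that the largest scale reaches \<open>t m\<close>.\<close>

lemma power_sum_lower:
  assumes m: "1 \<le> m" "m \<le> M" and \<rho>: "0 \<le> \<rho>" "\<rho> < \<alpha>" and \<gamma>: "\<alpha> - 1 < \<gamma>" "\<gamma> < \<rho>"
    and K: "2 \<le> K" and N: "1 \<le> N" "t m \<le> 2 ^ (N - 1) * (K * t 1)" and \<epsilon>: "0 \<le> \<epsilon>"
      "\<epsilon> * (1 - \<alpha>) * Beta (\<alpha> - \<rho>) (1 - \<alpha>) \<le> 1 / 2"
      "\<epsilon> * (1 - \<alpha>) * Beta (\<alpha> - \<rho>) (1 - \<alpha>) \<le> 2 powr (\<alpha> - \<gamma> - 1) * (1 - 2 powr (\<gamma> - \<rho>)) / 8"
    and small: "\<And>j \<sigma>. j \<in> {1..m} \<Longrightarrow> K * t 1 \<le> \<sigma> \<Longrightarrow> mesh_step t j \<le> t (j - 1) + \<sigma>"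
      "\<And>j \<sigma>. j \<in> {1..m} \<Longrightarrow> K * t 1 \<le> \<sigma> \<Longrightarrow>
        3 * (mesh_step t j / (t (j - 1) + \<sigma>)) \<le> \<epsilon> * (\<sigma> / (t j + \<sigma>)) powr \<rho>"
  shows "K powr (\<alpha> - \<gamma> - 1) / 8 * t m powr (- 1 - \<gamma>) \<le> L1_sum (power_sum \<gamma> (K * t 1) N) m"
proof -
  define E where "E = \<epsilon> * (1 - \<alpha>) * Beta (\<alpha> - \<rho>) (1 - \<alpha>)"
  define c where "c = t m"
  define \<sigma> where "\<sigma> k = 2 ^ k * (K * t 1)" for k :: nat
  define x where "x = K * t 1 / c"
  have t1: "0 < t 1" and c: "0 < c" and t1c: "t 1 \<le> c" using t_pos t_1_le m by (auto simp: c_def)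
  have x: "0 < x" "x \<le> K" using t1 c t1c K by (auto simp: x_def divide_le_eq)
  have "0 < Beta (\<alpha> - \<rho>) (1 - \<alpha>)"
    using \<alpha> \<rho> by (auto simp: Beta_def intro!: divide_pos_pos mult_pos_pos Gamma_real_pos)
  then have E: "0 \<le> E" using \<epsilon> \<alpha> by (simp add: E_def)
  have summand: "c powr (- 1 - \<gamma>) * (((2 ^ k * x) powr (\<alpha> - \<gamma>) - E * (2 ^ k * x) powr (\<rho> - \<gamma>)) / (1 + 2 ^ k * x))
      \<le> \<sigma> k powr (- \<gamma>) * L1_sum (\<lambda>i. if i = 0 then 0 else (t i + \<sigma> k) powr (\<alpha> - 1)) m" for k
  proof -
    define X where "X = 2 ^ k * x"
    have X: "0 < X" using x by (simp add: X_def)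
    have \<sigma>_eq: "\<sigma> k = X * c" using c by (simp add: X_def x_def \<sigma>_def)
    have \<sigma>: "0 < \<sigma> k" "K * t 1 \<le> \<sigma> k"
      using X c K t1 mult_right_mono[of 1 "2 ^ k" "K * t 1"] by (auto simp: \<sigma>_def)
    have "c powr (- 1 - \<gamma>) * ((X powr (\<alpha> - \<gamma>) - E * X powr (\<rho> - \<gamma>)) / (1 + X)) =
        (X * c) powr (- \<gamma>) * ((X powr \<alpha> - E * X powr \<rho>) / (c + X * c))"
    proof -
      have "c powr (- 1 - \<gamma>) = c powr (- \<gamma>) / c" using c powr_add[of c "- 1" "- \<gamma>"] by (simp add: powr_minus_divide)
      moreover have "X powr (\<alpha> - \<gamma>) - E * X powr (\<rho> - \<gamma>) = X powr (- \<gamma>) * (X powr \<alpha> - E * X powr \<rho>)"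
        using powr_add[of X "- \<gamma>" \<alpha>] powr_add[of X "- \<gamma>" \<rho>] by (simp add: algebra_simps)
      moreover have "c + X * c = c * (1 + X)" by (simp add: algebra_simps)
      moreover have "(X * c) powr (- \<gamma>) = X powr (- \<gamma>) * c powr (- \<gamma>)" using X c by (simp add: powr_mult)
      ultimately show ?thesis by simp
    qed
    also have "\<dots> = \<sigma> k powr (- \<gamma>) * (((\<sigma> k / c) powr \<alpha> - E * (\<sigma> k / c) powr \<rho>) / (c + \<sigma> k))"
      using X c \<sigma>_eq by simp
    also have "\<dots> \<le> \<sigma> k powr (- \<gamma>) * L1_sum (\<lambda>i. if i = 0 then 0 else (t i + \<sigma> k) powr (\<alpha> - 1)) m"
      using power_barrier[OF m \<sigma>(1) \<rho> \<epsilon>(1)] small \<sigma>(2) unfolding E_def c_def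
      by (intro mult_left_mono) auto
    finally show ?thesis unfolding X_def .
  qed
  have "K powr (\<alpha> - \<gamma> - 1) / 8 \<le>
      (\<Sum>k<N. ((2 ^ k * x) powr (\<alpha> - \<gamma>) - E * (2 ^ k * x) powr (\<rho> - \<gamma>)) / (1 + 2 ^ k * x))"
    using dyadic_lower_bound[of \<rho> \<alpha> \<gamma> x K N E] \<rho> \<gamma> x K N \<epsilon> E c
    by (simp add: E_def x_def c_def pos_le_divide_eq)
  then have "K powr (\<alpha> - \<gamma> - 1) / 8 * c powr (- 1 - \<gamma>) \<le> c powr (- 1 - \<gamma>) *
      (\<Sum>k<N. ((2 ^ k * x) powr (\<alpha> - \<gamma>) - E * (2 ^ k * x) powr (\<rho> - \<gamma>)) / (1 + 2 ^ k * x))"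
    by (subst mult.commute) (intro mult_left_mono, auto)
  also have "\<dots> \<le> (\<Sum>k<N. \<sigma> k powr (- \<gamma>) * L1_sum (\<lambda>i. if i = 0 then 0 else (t i + \<sigma> k) powr (\<alpha> - 1)) m)"
    unfolding sum_distrib_left by (intro sum_mono summand)
  also have "\<dots> = L1_sum (\<lambda>i. \<Sum>k<N. \<sigma> k powr (- \<gamma>) * (if i = 0 then 0 else (t i + \<sigma> k) powr (\<alpha> - 1))) m"
    by (rule L1_sum_linear[symmetric])
  also have "(\<lambda>i. \<Sum>k<N. \<sigma> k powr (- \<gamma>) * (if i = 0 then 0 else (t i + \<sigma> k) powr (\<alpha> - 1))) =
      power_sum \<gamma> (K * t 1) N"
    by (auto simp: power_sum_def \<sigma>_def fun_eq_iff)
  finally show ?thesis unfolding c_def .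
qed

text \<open>The same rescaling with \<open>y = t m / t 1\<close>. The dyadic estimate enters as a
  hypothesis on C so that its constant can be fixed before any mesh is chosen.\<close>

lemma power_sum_upper:
  assumes C: "\<And>x y N. 0 < x \<Longrightarrow> 1 \<le> y \<Longrightarrow> 1 \<le> x * y \<Longrightarrow> 1 \<le> N \<Longrightarrow> 1 \<le> 2 ^ (N - 1) * x \<Longrightarrow>
      (\<Sum>k<N. (2 ^ k * x) powr (- \<gamma>) * (1 + 2 ^ k * x) powr (\<alpha> - 1)) \<le>
      C * (y powr (max 0 \<gamma>) * log_factor \<gamma> 1 y)"
    and m: "1 \<le> m" "m \<le> M" and K: "1 \<le> K" and N: "1 \<le> N" "t m \<le> 2 ^ (N - 1) * (K * t 1)"
  shows "power_sum \<gamma> (K * t 1) N m \<le>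
    C * (t 1 powr (min \<gamma> 0 - \<gamma>) * log_factor \<gamma> (t 1) (t m)) * t m powr (\<alpha> - 1 - min \<gamma> 0)"
proof -
  define c where "c = t m"
  define x where "x = K * t 1 / c"
  have t1: "0 < t 1" and c: "0 < c" and t1c: "t 1 \<le> c" using t_pos t_1_le m by (auto simp: c_def)
  have x: "0 < x" using t1 c K by (auto simp: x_def)
  have summand: "(2 ^ k * (K * t 1)) powr (- \<gamma>) * (c + 2 ^ k * (K * t 1)) powr (\<alpha> - 1) =
      c powr (\<alpha> - 1 - \<gamma>) * ((2 ^ k * x) powr (- \<gamma>) * (1 + 2 ^ k * x) powr (\<alpha> - 1))" for k :: nat
  proof -
    define X where "X = 2 ^ k * x"
    have X: "0 < X" using x by (simp add: X_def)
    have \<sigma>_eq: "2 ^ k * (K * t 1) = X * c" using c by (simp add: X_def x_def)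
    have "c + X * c = c * (1 + X)" by (simp add: algebra_simps)
    then have "(c + X * c) powr (\<alpha> - 1) = c powr (\<alpha> - 1) * (1 + X) powr (\<alpha> - 1)"
      using c X by (simp add: powr_mult)
    moreover have "c powr (\<alpha> - 1 - \<gamma>) = c powr (\<alpha> - 1) * c powr (- \<gamma>)" by (simp flip: powr_add)
    moreover have "(X * c) powr (- \<gamma>) = X powr (- \<gamma>) * c powr (- \<gamma>)" using X c by (simp add: powr_mult)
    ultimately show ?thesis unfolding \<sigma>_eq X_def[symmetric] by simp
  qed
  have "power_sum \<gamma> (K * t 1) N m =
      c powr (\<alpha> - 1 - \<gamma>) * (\<Sum>k<N. (2 ^ k * x) powr (- \<gamma>) * (1 + 2 ^ k * x) powr (\<alpha> - 1))"
    using m summand unfolding power_sum_def c_def[symmetric] by (simp add: sum_distrib_left)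
  also have "\<dots> \<le> c powr (\<alpha> - 1 - \<gamma>) * (C * ((c / t 1) powr (max 0 \<gamma>) * log_factor \<gamma> 1 (c / t 1)))"
    using x t1 c t1c K N by (intro mult_left_mono C) (auto simp: x_def c_def pos_le_divide_eq)
  also have "log_factor \<gamma> 1 (c / t 1) = log_factor \<gamma> (t 1) c" by (simp add: log_factor_def)
  also have "c powr (\<alpha> - 1 - \<gamma>) * (C * ((c / t 1) powr (max 0 \<gamma>) * log_factor \<gamma> (t 1) c)) =
      C * (t 1 powr (min \<gamma> 0 - \<gamma>) * log_factor \<gamma> (t 1) c) * c powr (\<alpha> - 1 - min \<gamma> 0)"
  proof -
    have "(c / t 1) powr (max 0 \<gamma>) = c powr (\<gamma> - min \<gamma> 0) * t 1 powr (min \<gamma> 0 - \<gamma>)"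
      using c t1 by (cases "\<gamma> \<le> 0") (auto simp: powr_divide powr_minus_divide)
    then have "c powr (\<alpha> - 1 - \<gamma>) * (C * ((c / t 1) powr (max 0 \<gamma>) * log_factor \<gamma> (t 1) c)) =
        C * (t 1 powr (min \<gamma> 0 - \<gamma>) * log_factor \<gamma> (t 1) c) *
        (c powr (\<alpha> - 1 - \<gamma>) * c powr (\<gamma> - min \<gamma> 0))"
      by (simp only: mult_ac)
    also have "c powr (\<alpha> - 1 - \<gamma>) * c powr (\<gamma> - min \<gamma> 0) = c powr (\<alpha> - 1 - min \<gamma> 0)"
      by (subst powr_add[symmetric]) (simp add: algebra_simps)
    finally show ?thesis .
  qed
  finally show ?thesis unfolding c_def .
qed

text \<open>A step of at most \<open>t (j - 1) + s\<close> no more than doubles the shifted time, so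
  each power drops by a factor of at most \<open>2 powr (1 - \<alpha>)\<close>, which is below
  2.\<close>

lemma power_sum_halving:
  assumes j: "j \<in> {1..M}" and \<sigma>: "0 < \<sigma>"
    and small: "\<And>s. \<sigma> \<le> s \<Longrightarrow> mesh_step t j \<le> t (j - 1) + s"
  shows "power_sum \<gamma> \<sigma> N (j - 1) \<le> 2 * power_sum \<gamma> \<sigma> N j"
proof (cases "j - 1 = 0")
  case True
  then show ?thesis using power_sum_nonneg[of \<gamma> \<sigma> N j] by (simp add: power_sum_def)
next
  case False
  have "(t (j - 1) + 2 ^ k * \<sigma>) powr (\<alpha> - 1) \<le> 2 * (t j + 2 ^ k * \<sigma>) powr (\<alpha> - 1)" for k :: nat
  proof -
    define s where "s = 2 ^ k * \<sigma>"
    have s: "\<sigma> \<le> s" using \<sigma> mult_right_mono[of 1 "2 ^ k" \<sigma>] by (simp add: s_def)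
    have pos: "0 < t j" using t_pos j by auto
    have "t j + s \<le> 2 * (t (j - 1) + s)" using small[OF s] by (simp add: mesh_step_def algebra_simps)
    then have "(t j + s) / 2 \<le> t (j - 1) + s" by simp
    then have "(t (j - 1) + s) powr (\<alpha> - 1) \<le> ((t j + s) / 2) powr (\<alpha> - 1)"
      using \<alpha> pos s \<sigma> by (intro powr_mono2') auto
    also have "\<dots> = 2 powr (1 - \<alpha>) * (t j + s) powr (\<alpha> - 1)"
      using pos s \<sigma> powr_minus_divide[of 2 "1 - \<alpha>"] by (simp add: powr_divide)
    also have "\<dots> \<le> 2 powr 1 * (t j + s) powr (\<alpha> - 1)"
      using \<alpha> by (intro mult_right_mono powr_mono) auto
    finally show ?thesis by (simp add: s_def)
  qed
  then have "(\<Sum>k<N. (2 ^ k * \<sigma>) powr (- \<gamma>) * (t (j - 1) + 2 ^ k * \<sigma>) powr (\<alpha> - 1)) \<le>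
      (\<Sum>k<N. (2 ^ k * \<sigma>) powr (- \<gamma>) * (2 * (t j + 2 ^ k * \<sigma>) powr (\<alpha> - 1)))"
    by (intro sum_mono mult_left_mono) auto
  then show ?thesis using False by (simp add: power_sum_def sum_distrib_left mult_ac)
qed

text \<open>Grading bounds the relative step by \<open>c3 * (t 1 / t j) powr \<rho>\<close>, and
  \<open>t 1 \<le> \<sigma> / K\<close> turns K into a small factor
  \<open>K powr (- \<rho>)\<close>. Its bound by 1 / 2 permits passing from
  \<open>t j + \<sigma>\<close> to \<open>t (j - 1) + \<sigma>\<close> at the cost of a factor 2,
  hence 6 = 2 * 3.\<close>

lemma quasi_graded_small:
  assumes step: "\<And>j. j \<in> {1..M} \<Longrightarrow> mesh_step t j \<le> c3 * t 1 powr (1 / r) * t j powr (1 - 1 / r)"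
    and \<rho>: "0 < \<rho>" "\<rho> \<le> 1 / r" "\<rho> \<le> 1" and c3: "0 \<le> c3"
    and K: "0 < K" "c3 * K powr (- \<rho>) \<le> 1 / 2" "6 * (c3 * K powr (- \<rho>)) \<le> \<epsilon>"
    and j: "j \<in> {1..M}" and \<sigma>: "K * t 1 \<le> \<sigma>"
  shows "mesh_step t j \<le> t (j - 1) + \<sigma>"
    and "3 * (mesh_step t j / (t (j - 1) + \<sigma>)) \<le> \<epsilon> * (\<sigma> / (t j + \<sigma>)) powr \<rho>"
proof -
  define e where "e = c3 * K powr (- \<rho>)"
  define w where "w = (\<sigma> / (t j + \<sigma>)) powr \<rho>"
  have pos: "0 < t 1" "0 < t j" "t 1 \<le> t j" using t_pos t_1_le j by auto
  then have \<sigma>0: "0 < \<sigma>" using K \<sigma> by (smt (verit) mult_pos_pos)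
  have e: "0 \<le> e" "e \<le> 1 / 2" "6 * e \<le> \<epsilon>" using c3 K by (auto simp: e_def)
  have "w \<le> 1 powr \<rho>" unfolding w_def using \<sigma>0 pos \<rho> by (intro powr_mono2) auto
  then have w: "0 \<le> w" "w \<le> 1" by (auto simp: w_def)
  have "mesh_step t j \<le> c3 * ((t 1 / t j) powr (1 / r) * t j)"
    using step[OF j] pos by (simp add: powr_diff powr_divide)
  also have "\<dots> \<le> c3 * ((t 1 / t j) powr \<rho> * t j)"
    using c3 pos \<rho> by (intro mult_left_mono mult_right_mono powr_mono') auto
  also have "\<dots> \<le> c3 * ((\<sigma> / K / t j) powr \<rho> * t j)"
    using c3 pos \<rho> \<sigma> K by (intro mult_left_mono mult_right_mono powr_mono2 divide_right_mono)
      (auto simp: pos_le_divide_eq mult.commute)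
  also have "\<dots> = e * (\<sigma> powr \<rho> * t j powr (1 - \<rho>))"
    using pos K \<sigma>0 by (simp add: e_def powr_divide powr_mult powr_diff powr_minus_divide)
  also have "\<dots> \<le> e * (\<sigma> powr \<rho> * (t j + \<sigma>) powr (1 - \<rho>))"
    using e pos \<sigma>0 \<rho> by (intro mult_left_mono powr_mono2) auto
  also have "\<dots> = e * w * (t j + \<sigma>)"
    using pos \<sigma>0 by (simp add: w_def powr_divide powr_diff)
  finally have 1: "mesh_step t j \<le> e * w * (t j + \<sigma>)" .
  also have "\<dots> \<le> 1 / 2 * 1 * (t j + \<sigma>)"
    using e w pos \<sigma>0 by (intro mult_right_mono mult_mono) auto
  finally have 2: "mesh_step t j \<le> (t j + \<sigma>) / 2" by simp
  then have 3: "(t j + \<sigma>) / 2 \<le> t (j - 1) + \<sigma>" by (simp add: mesh_step_def)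
  with 2 show "mesh_step t j \<le> t (j - 1) + \<sigma>" by simp
  have "3 * mesh_step t j \<le> (6 * e) * w * ((t j + \<sigma>) / 2)" using 1 by simp
  also have "\<dots> \<le> \<epsilon> * w * (t (j - 1) + \<sigma>)"
    using e w 3 pos \<sigma>0 by (intro mult_mono) auto
  finally show "3 * (mesh_step t j / (t (j - 1) + \<sigma>)) \<le> \<epsilon> * (\<sigma> / (t j + \<sigma>)) powr \<rho>"
    using 3 pos \<sigma>0 by (simp add: w_def pos_divide_le_eq)
qed

end

section \<open>Stability constants\<close>

definition decay_bound :: "real \<Rightarrow> real \<Rightarrow> real \<Rightarrow> real \<Rightarrow> real" where
  "decay_bound \<alpha> \<gamma> \<tau> x = log_factor \<gamma> \<tau> x * \<tau> * x powr (\<alpha> - 1) * (\<tau> / x) powr (min 0 \<gamma>)"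

text \<open>The claim for one mesh with both constants exposed; uniformity in M then means that a
  single \<open>C1\<close> serves all meshes of the family.\<close>

definition stable :: "real \<Rightarrow> real \<Rightarrow> real \<Rightarrow> real \<Rightarrow> (nat \<Rightarrow> real) \<Rightarrow> nat \<Rightarrow> real \<Rightarrow> real \<Rightarrow> bool" where
  "stable \<alpha> \<gamma> lam0 lam1 t M C0 C1 \<longleftrightarrow> (\<forall>U. U 0 = 0 \<longrightarrow>
     (\<forall>j\<in>{1..M}. (L1_op \<alpha> t U j - lam0 * U j) - lam1 * U (j - 1) \<le> C0 * (t 1 / t j) powr (\<gamma> + 1)) \<longrightarrow>
     (\<forall>j\<in>{1..M}. U j \<le> C1 * decay_bound \<alpha> \<gamma> (t 1) (t j)))"

text \<open>Near 0 the extra power p makes the left side smaller than the first term on the right.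
  Away from 0 it is bounded, and so dominated by R times a power that stays bounded below on (0,
  T].\<close>

lemma power_absorb_single:
  fixes a b c e p T :: real
  assumes "0 < p" "0 < c" "0 \<le> b" "a \<le> 0" "0 < T"
  obtains R where "0 \<le> R"
    "\<And>x. 0 < x \<Longrightarrow> x \<le> T \<Longrightarrow> b * x powr (e + p) \<le> c * x powr e + R * x powr a"
proof -
  define y where "y = (c / (b + 1)) powr (1 / p)"
  \<comment> \<open>A bound for \<open>x powr (e + p)\<close> between y and T whatever the sign of e
    + p: one summand per direction of monotonicity.\<close>
  define S where "S = y powr (e + p) + T powr (e + p)"
  have y: "0 < y" "y powr p = c / (b + 1)" using assms by (auto simp: y_def powr_powr)
  show ?thesis
  proof (rule that[of "b * S * T powr (- a)"])
    show "0 \<le> b * S * T powr (- a)" using assms by (simp add: S_def)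
    fix x assume x: "0 < x" "x \<le> T"
    show "b * x powr (e + p) \<le> c * x powr e + b * S * T powr (- a) * x powr a"
    proof (cases "x \<le> y")
      case True
      have "x powr p \<le> c / (b + 1)" unfolding y(2)[symmetric] using True x assms by (intro powr_mono2) auto
      then have "b * x powr p \<le> b * (c / (b + 1))" using assms by (intro mult_left_mono) auto
      also have "\<dots> \<le> c" using assms by (simp add: field_simps)
      finally have "x powr e * (b * x powr p) \<le> x powr e * c" by (intro mult_left_mono) auto
      moreover have "0 \<le> b * S * T powr (- a) * x powr a" using assms by (simp add: S_def)
      ultimately show ?thesis by (simp add: powr_add mult_ac)
    next
      case False
      have "x powr (e + p) \<le> S"
      proof (cases "e + p \<ge> 0")
        case True
        then have "x powr (e + p) \<le> T powr (e + p)" using x by (intro powr_mono2) auto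
        then show ?thesis by (simp add: S_def add_increasing)
      next
        case nonneg: False
        then have "x powr (e + p) \<le> y powr (e + p)" using y False by (intro powr_mono2') auto
        then show ?thesis by (simp add: S_def add_increasing2)
      qed
      then have "b * x powr (e + p) \<le> b * S * 1" using assms by (simp add: mult_left_mono)
      also have "(1 :: real) = T powr (- a) * T powr a" using assms by (simp flip: powr_add)
      also have "b * S * (T powr (- a) * T powr a) \<le> b * S * (T powr (- a) * x powr a)"
        using assms x by (intro mult_left_mono powr_mono2') (auto simp: S_def)
      finally show ?thesis using assms by (simp add: mult.assoc add_increasing)
    qed
  qed
qed

lemma power_absorb:
  fixes a b b' c e p q T :: real
  assumes "0 < p" "0 < q" "0 < c" "0 \<le> b" "0 \<le> b'" "a \<le> 0" "0 < T"
  obtains R where "0 \<le> R"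
    "\<And>x. 0 < x \<Longrightarrow> x \<le> T \<Longrightarrow> b * x powr (e + p) + b' * x powr (e + q) \<le> c * x powr e + R * x powr a"
proof -
  obtain R where R: "0 \<le> R" "\<And>x. 0 < x \<Longrightarrow> x \<le> T \<Longrightarrow> b * x powr (e + p) \<le> c / 2 * x powr e + R * x powr a"
    using power_absorb_single[of p "c / 2" b a T e] assms by auto
  obtain R' where R': "0 \<le> R'" "\<And>x. 0 < x \<Longrightarrow> x \<le> T \<Longrightarrow> b' * x powr (e + q) \<le> c / 2 * x powr e + R' * x powr a"
    using power_absorb_single[of q "c / 2" b' a T e] assms by auto
  show ?thesis
  proof (rule that[of "R + R'"])
    fix x assume "0 < x" "x \<le> T"
    from R(2)[OF this] R'(2)[OF this]
    show "b * x powr (e + p) + b' * x powr (e + q) \<le> c * x powr e + (R + R') * x powr a"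
      by (simp add: algebra_simps)
  qed (use R R' in simp)
qed

section \<open>Stability on a single mesh\<close>

context L1_mesh
begin

lemma log_factor_ge_1: "1 \<le> j \<Longrightarrow> j \<le> M \<Longrightarrow> 1 \<le> log_factor \<gamma> (t 1) (t j)"
  using t_1_le[of j] t_pos[of 1] by (auto simp: log_factor_def)

lemma log_factor_mono: "1 \<le> i \<Longrightarrow> i \<le> j \<Longrightarrow> j \<le> M \<Longrightarrow> log_factor \<gamma> (t 1) (t i) \<le> log_factor \<gamma> (t 1) (t j)"
  using t_mono[of i j] t_pos[of 1] t_pos[of i] by (auto simp: log_factor_def divide_right_mono)

lemma decay_bound_pos: "1 \<le> j \<Longrightarrow> j \<le> M \<Longrightarrow> 0 < decay_bound \<alpha> \<gamma> (t 1) (t j)"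
  using log_factor_ge_1[of j \<gamma>] t_pos[of 1] t_pos[of j] by (simp add: decay_bound_def)

lemma stable_mono: "stable \<alpha> \<gamma> lam0 lam1 t M C0 C \<Longrightarrow> C \<le> C' \<Longrightarrow> stable \<alpha> \<gamma> lam0 lam1 t M C0 C'"
  unfolding stable_def
proof (intro allI impI ballI)
  fix U j
  assume *: "\<forall>U. U 0 = 0 \<longrightarrow>
     (\<forall>j\<in>{1..M}. (L1_op \<alpha> t U j - lam0 * U j) - lam1 * U (j - 1) \<le> C0 * (t 1 / t j) powr (\<gamma> + 1)) \<longrightarrow>
     (\<forall>j\<in>{1..M}. U j \<le> C * decay_bound \<alpha> \<gamma> (t 1) (t j))"
    and "U 0 = 0" "\<forall>j\<in>{1..M}. (L1_op \<alpha> t U j - lam0 * U j) - lam1 * U (j - 1) \<le> C0 * (t 1 / t j) powr (\<gamma> + 1)"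
    and j: "j \<in> {1..M}" and "C \<le> C'"
  then have "U j \<le> C * decay_bound \<alpha> \<gamma> (t 1) (t j)" by blast
  also have "\<dots> \<le> C' * decay_bound \<alpha> \<gamma> (t 1) (t j)"
    using \<open>C \<le> C'\<close> decay_bound_pos[of j \<gamma>] j by (intro mult_right_mono) auto
  finally show "U j \<le> C' * decay_bound \<alpha> \<gamma> (t 1) (t j)" .
qed

text \<open>The equations form a lower triangular system whose diagonal entries are positive by the
  mesh condition, so they can be solved forward in j.\<close>

lemma exists_solution:
  assumes diag: "\<And>j. j \<in> {1..M} \<Longrightarrow> lam0 * mesh_step t j powr \<alpha> < 1 / Gamma (2 - \<alpha>)"
    and "n \<le> M"
  shows "\<exists>W. W 0 = 0 \<and> (\<forall>j\<in>{1..n}. L1_op \<alpha> t W j - lam0 * W j - lam1 * W (j - 1) = f j)"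
  using \<open>n \<le> M\<close>
proof (induction n)
  case (Suc n)
  then obtain W where W: "W 0 = 0" "\<And>j. j \<in> {1..n} \<Longrightarrow> L1_op \<alpha> t W j - lam0 * W j - lam1 * W (j - 1) = f j"
    by auto
  define G where "G = Gamma (1 - \<alpha>)"
  define w where "w = wt (Suc n) (Suc n) / G"
  define S where "S = (\<Sum>j=1..n. (W j - W (j - 1)) * wt (Suc n) j) / G"
  define v where "v = (f (Suc n) + lam1 * W n - S + w * W n) / (w - lam0)"
  define W' where "W' = W(Suc n := v)"
  have "mesh_step t (Suc n) powr \<alpha> > 0" using t_step[of "Suc n"] Suc.prems by (auto simp: mesh_step_def)
  moreover have "Gamma (2 - \<alpha>) > 0" using \<alpha> by (auto intro: Gamma_real_pos)
  ultimately have "lam0 < mesh_step t (Suc n) powr (- \<alpha>) / Gamma (2 - \<alpha>)"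
    using diag[of "Suc n"] Suc.prems by (simp add: powr_minus divide_simps mult_ac)
  then have w: "lam0 < w" using wt_diag[of "Suc n"] Suc.prems by (simp add: w_def G_def)
  have same: "L1_sum W' j = L1_sum W j" if "j \<le> n" for j
    unfolding L1_sum_def using that by (intro sum.cong) (auto simp: W'_def)
  have "(\<Sum>j=1..n. (W' j - W' (j - 1)) * wt (Suc n) j) = (\<Sum>j=1..n. (W j - W (j - 1)) * wt (Suc n) j)"
    by (intro sum.cong) (auto simp: W'_def)
  then have "L1_sum W' (Suc n) = (\<Sum>j=1..n. (W j - W (j - 1)) * wt (Suc n) j) + (v - W n) * wt (Suc n) (Suc n)"
    unfolding L1_sum_def by (simp add: W'_def)
  then have "L1_op \<alpha> t W' (Suc n) = S + (v - W n) * w"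
    unfolding L1_op_eq S_def w_def G_def[symmetric] by (simp add: add_divide_distrib)
  moreover have "(w - lam0) * v = f (Suc n) + lam1 * W n - S + w * W n"
    using w by (simp add: v_def)
  ultimately have new: "L1_op \<alpha> t W' (Suc n) - lam0 * W' (Suc n) - lam1 * W' (Suc n - 1) = f (Suc n)"
    by (simp add: W'_def algebra_simps)
  have "L1_op \<alpha> t W' j - lam0 * W' j - lam1 * W' (j - 1) = f j" if "j \<in> {1..Suc n}" for j
  proof (cases "j = Suc n")
    case False
    then have "j \<in> {1..n}" using that by auto
    moreover from this have "L1_op \<alpha> t W' j = L1_op \<alpha> t W j" unfolding L1_op_eq using same by simp
    moreover have "W' j = W j" "W' (j - 1) = W (j - 1)" using False that by (auto simp: W'_def)
    ultimately show ?thesis using W(2)[of j] by simp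
  qed (use new in simp)
  moreover have "W' 0 = 0" using W by (simp add: W'_def)
  ultimately show ?case by blast
qed auto

text \<open>By comparison the solution W of the equations dominates every admissible U, so finitely
  many ratios determine a constant. This handles the coarse meshes, whose steps may be too long for
  the exponential barrier.\<close>

lemma stable_single_mesh:
  assumes diag: "\<And>j. j \<in> {1..M} \<Longrightarrow> lam0 * mesh_step t j powr \<alpha> < 1 / Gamma (2 - \<alpha>)"
    and lam1: "0 \<le> lam1"
  shows "\<exists>C>0. stable \<alpha> \<gamma> lam0 lam1 t M C0 C"
proof -
  obtain W where W: "W 0 = 0"
    "\<And>j. j \<in> {1..M} \<Longrightarrow> L1_op \<alpha> t W j - lam0 * W j - lam1 * W (j - 1) = C0 * (t 1 / t j) powr (\<gamma> + 1)"
    using exists_solution[OF diag order_refl, of lam1 "\<lambda>j. C0 * (t 1 / t j) powr (\<gamma> + 1)"] by auto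
  define b where "b j = decay_bound \<alpha> \<gamma> (t 1) (t j)" for j
  have b: "0 < b j" if "j \<in> {1..M}" for j using decay_bound_pos that by (simp add: b_def)
  define C where "C = 1 + (\<Sum>j\<in>{1..M}. \<bar>W j\<bar> / b j)"
  have nonneg: "0 \<le> \<bar>W j\<bar> / b j" if "j \<in> {1..M}" for j using b[OF that] by simp
  have "0 < C" unfolding C_def using nonneg by (intro add_pos_nonneg sum_nonneg) auto
  moreover have "stable \<alpha> \<gamma> lam0 lam1 t M C0 C"
    unfolding stable_def
  proof (intro allI impI ballI)
    fix U j
    assume U0: "U 0 = 0" and j: "j \<in> {1..M}"
      and U: "\<forall>j\<in>{1..M}. L1_op \<alpha> t U j - lam0 * U j - lam1 * U (j - 1) \<le> C0 * (t 1 / t j) powr (\<gamma> + 1)"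
    have "U j \<le> W j"
      by (rule comparison[OF diag lam1 order_refl, where U = U and B = W]) (use U0 U W j in auto)
    also have "W j \<le> \<bar>W j\<bar> / b j * b j" using b[OF j] by simp
    also have "\<dots> \<le> C * b j"
    proof (intro mult_right_mono)
      have "\<bar>W j\<bar> / b j \<le> (\<Sum>j\<in>{1..M}. \<bar>W j\<bar> / b j)" by (rule member_le_sum) (use j nonneg in auto)
      then show "\<bar>W j\<bar> / b j \<le> C" by (simp add: C_def)
    qed (use b[OF j] in simp)
    finally show "U j \<le> C * decay_bound \<alpha> \<gamma> (t 1) (t j)" by (simp add: b_def)
  qed
  ultimately show ?thesis by blast
qed

end

text \<open>The barrier has three layers: the dyadic sum for \<gamma> produces the load, and the sum
  for \<open>\<gamma>2\<close> and the exponential sequence absorb the terms with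
  \<open>lam\<close>. The last two carry the factor L of the upper bound for the first, since they
  must absorb \<open>lam\<close> times that layer.\<close>

lemma stable_singular:
  fixes \<alpha> \<gamma> \<rho> r c3 T \<mu> lam0 lam1 :: real
  assumes \<alpha>: "0 < \<alpha>" "\<alpha> < 1" and lam01: "0 \<le> lam0" "0 \<le> lam1"
    and \<mu>: "0 < \<mu>" "6 * (Gamma (1 - \<alpha>) * (lam0 + 2 * lam1)) \<le> \<mu> powr \<alpha>"
    and \<rho>: "0 < \<rho>" "\<rho> \<le> 1 / r" "\<rho> < \<alpha>" and \<gamma>: "\<alpha> - 1 < \<gamma>" "\<gamma> < \<rho>"
    and c3: "0 < c3" and T: "0 < T"
  obtains C where "0 < C"
    "\<And>t M C0. L1_mesh \<alpha> t M \<Longrightarrow> t M \<le> T \<Longrightarrow> 0 \<le> C0 \<Longrightarrow>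
      (\<And>j. j \<in> {1..M} \<Longrightarrow> lam0 * mesh_step t j powr \<alpha> < 1 / Gamma (2 - \<alpha>)) \<Longrightarrow>
      (\<And>j. j \<in> {1..M} \<Longrightarrow> mesh_step t j \<le> c3 * t 1 powr (1 / r) * t j powr (1 - 1 / r)) \<Longrightarrow>
      (\<And>j. j \<in> {1..M} \<Longrightarrow> mesh_step t j \<le> 1 / \<mu>) \<Longrightarrow>
      stable \<alpha> \<gamma> lam0 lam1 t M C0 (C * C0)"
proof -
  define g where "g = Gamma (1 - \<alpha>)"
  define lam where "lam = g * (lam0 + 2 * lam1)"
  \<comment> \<open>The sum with exponent \<open>\<gamma>\<close> is of order \<open>s powr (\<alpha> - 1 - \<gamma>1)\<close>. Any \<open>\<gamma>2\<close> with
    \<open>\<gamma>1 - \<alpha> < \<gamma>2 < \<gamma>1\<close> makes the residual \<open>s powr (- 1 - \<gamma>2)\<close> dominate it for small \<open>s\<close>;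
    away from 0 the exponential barrier does.\<close>
  define \<gamma>1 where "\<gamma>1 = min \<gamma> 0"
  define \<gamma>2 where "\<gamma>2 = (max (\<alpha> - 1) (\<gamma>1 - \<alpha>) + \<gamma>1) / 2"
  have g: "0 < g" unfolding g_def using \<alpha> by (auto intro: Gamma_real_pos)
  have lam: "0 \<le> lam" using g lam01 by (simp add: lam_def)
  have \<gamma>1: "\<alpha> - 1 < \<gamma>1" "\<gamma>1 \<le> 0" using \<gamma> \<alpha> by (auto simp: \<gamma>1_def)
  then have \<gamma>2: "\<alpha> - 1 < \<gamma>2" "\<gamma>1 - \<alpha> < \<gamma>2" "\<gamma>2 < \<gamma>1"
    using \<alpha> by (auto simp: \<gamma>2_def max_def)
  define Bt where "Bt = (1 - \<alpha>) * Beta (\<alpha> - \<rho>) (1 - \<alpha>)"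
  have Bt: "0 < Bt"
    using \<alpha> \<rho> by (auto simp: Bt_def Beta_def intro!: divide_pos_pos mult_pos_pos Gamma_real_pos)
  define E where "E \<delta> = 2 powr (\<alpha> - \<delta> - 1) * (1 - 2 powr (\<delta> - \<rho>)) / 8" for \<delta> :: real
  have E: "0 < E \<delta>" if "\<delta> < \<rho>" for \<delta>
    using two_powr_minus_less_one[of "\<rho> - \<delta>"] that by (simp add: E_def)
  \<comment> \<open>The error coefficient of each shifted power is \<open>\<epsilon> * Bt\<close>;
    it has to meet the thresholds of the dyadic lower bound for both exponents.\<close>
  define \<epsilon> where "\<epsilon> = min (1 / 2) (min (E \<gamma>) (E \<gamma>2)) / Bt"
  have \<epsilon>: "0 < \<epsilon>" "\<epsilon> * (1 - \<alpha>) * Beta (\<alpha> - \<rho>) (1 - \<alpha>) \<le> 1 / 2"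
    "\<epsilon> * (1 - \<alpha>) * Beta (\<alpha> - \<rho>) (1 - \<alpha>) \<le> E \<gamma>" "\<epsilon> * (1 - \<alpha>) * Beta (\<alpha> - \<rho>) (1 - \<alpha>) \<le> E \<gamma>2"
  proof -
    have "\<epsilon> * (1 - \<alpha>) * Beta (\<alpha> - \<rho>) (1 - \<alpha>) = \<epsilon> * Bt" by (simp add: Bt_def)
    also have "\<dots> = min (1 / 2) (min (E \<gamma>) (E \<gamma>2))" using Bt by (simp add: \<epsilon>_def)
    finally have "\<epsilon> * (1 - \<alpha>) * Beta (\<alpha> - \<rho>) (1 - \<alpha>) = min (1 / 2) (min (E \<gamma>) (E \<gamma>2))" .
    then show "\<epsilon> * (1 - \<alpha>) * Beta (\<alpha> - \<rho>) (1 - \<alpha>) \<le> 1 / 2"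
      "\<epsilon> * (1 - \<alpha>) * Beta (\<alpha> - \<rho>) (1 - \<alpha>) \<le> E \<gamma>" "\<epsilon> * (1 - \<alpha>) * Beta (\<alpha> - \<rho>) (1 - \<alpha>) \<le> E \<gamma>2"
      by linarith+
    show "0 < \<epsilon>" using E[of \<gamma>] E[of \<gamma>2] \<gamma> \<gamma>1 \<gamma>2 \<rho> Bt by (simp add: \<epsilon>_def)
  qed
  define \<eta> where "\<eta> = min (1 / 2) (\<epsilon> / 6)"
  have \<eta>: "0 < \<eta>" "\<eta> \<le> 1 / 2" "6 * \<eta> \<le> \<epsilon>" using \<epsilon> by (auto simp: \<eta>_def min_def)
  \<comment> \<open>Large enough for \<open>c3 * K powr (- \<rho>) \<le> \<eta>\<close>.\<close>
  define K where "K = max 2 ((c3 / \<eta>) powr (1 / \<rho>))"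
  have K: "2 \<le> K" by (simp add: K_def)
  have "c3 / \<eta> = ((c3 / \<eta>) powr (1 / \<rho>)) powr \<rho>" using c3 \<eta> \<rho> by (simp add: powr_powr)
  also have "\<dots> \<le> K powr \<rho>" using \<rho> by (intro powr_mono2) (auto simp: K_def)
  finally have "c3 * K powr (- \<rho>) \<le> \<eta>"
    using \<eta> K by (simp add: powr_minus_divide pos_divide_le_eq mult.commute)
  then have K': "c3 * K powr (- \<rho>) \<le> 1 / 2" "6 * (c3 * K powr (- \<rho>)) \<le> \<epsilon>" using \<eta> by auto
  obtain A where A: "0 < A" "\<And>x y N. 0 < x \<Longrightarrow> 1 \<le> y \<Longrightarrow> 1 \<le> x * y \<Longrightarrow> 1 \<le> N \<Longrightarrow> 1 \<le> 2 ^ (N - 1) * x \<Longrightarrow>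
      (\<Sum>k<N. (2 ^ k * x) powr (- \<gamma>) * (1 + 2 ^ k * x) powr (\<alpha> - 1)) \<le> A * (y powr (max 0 \<gamma>) * log_factor \<gamma> 1 y)"
    by (rule dyadic_upper_bound[OF \<alpha>(2) \<gamma>(1)]) blast
  obtain A2 where A2: "0 < A2" "\<And>x y N. 0 < x \<Longrightarrow> 1 \<le> y \<Longrightarrow> 1 \<le> x * y \<Longrightarrow> 1 \<le> N \<Longrightarrow> 1 \<le> 2 ^ (N - 1) * x \<Longrightarrow>
      (\<Sum>k<N. (2 ^ k * x) powr (- \<gamma>2) * (1 + 2 ^ k * x) powr (\<alpha> - 1)) \<le> A2 * (y powr (max 0 \<gamma>2) * log_factor \<gamma>2 1 y)"
    by (rule dyadic_upper_bound[OF \<alpha>(2) \<gamma>2(1)]) blast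
  define c where "c \<delta> = K powr (\<alpha> - \<delta> - 1) / 8" for \<delta> :: real
  have c: "0 < c \<delta>" for \<delta> using K by (simp add: c_def)
  \<comment> \<open>The exponents are split to display their gains over
    \<open>- 1 - \<gamma>2\<close>; both \<alpha> + \<open>\<gamma>2\<close> -
    \<open>\<gamma>1\<close> and \<alpha> are positive.\<close>
  obtain R where R: "0 \<le> R" "\<And>x. 0 < x \<Longrightarrow> x \<le> T \<Longrightarrow>
      lam * A * x powr ((- 1 - \<gamma>2) + (\<alpha> + \<gamma>2 - \<gamma>1)) + lam * A2 * x powr ((- 1 - \<gamma>2) + \<alpha>) \<le>
      c \<gamma>2 * x powr (- 1 - \<gamma>2) + R * x powr (- \<alpha>)"
    using power_absorb[of "\<alpha> + \<gamma>2 - \<gamma>1" \<alpha> "c \<gamma>2" "lam * A" "lam * A2" "- \<alpha>" T "- 1 - \<gamma>2"]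
      \<gamma>2 \<alpha> c[of \<gamma>2] lam A A2 T by auto
  \<comment> \<open>The three layers measured in units of
    \<open>x powr (\<alpha> - 1 - \<gamma>1)\<close> on (0, T], with L factored out; this works
    since \<open>\<gamma>2\<close> < \<open>\<gamma>1\<close> and \<open>\<gamma>1\<close> >
    \<alpha> - 1.\<close>
  define D where "D = A + A2 * T powr (\<gamma>1 - \<gamma>2) + 2 * R * exp (\<mu> * T) * T powr (1 + \<gamma>1 - \<alpha>)"
  have D: "0 < D" using A A2 R by (auto simp: D_def intro!: add_pos_nonneg)
  show ?thesis
  proof (rule that[of "g / c \<gamma> * D"])
    show "0 < g / c \<gamma> * D" using g c D by simp
    fix t M and C0 :: real
    assume mesh: "L1_mesh \<alpha> t M" and tM: "t M \<le> T" and C0: "0 \<le> C0"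
      and diag: "\<And>j. j \<in> {1..M} \<Longrightarrow> lam0 * mesh_step t j powr \<alpha> < 1 / Gamma (2 - \<alpha>)"
      and graded: "\<And>j. j \<in> {1..M} \<Longrightarrow> mesh_step t j \<le> c3 * t 1 powr (1 / r) * t j powr (1 - 1 / r)"
      and step: "\<And>j. j \<in> {1..M} \<Longrightarrow> mesh_step t j \<le> 1 / \<mu>"
    interpret L1_mesh \<alpha> t M by (rule mesh)
    have small: "mesh_step t j \<le> t (j - 1) + \<sigma>"
      "3 * (mesh_step t j / (t (j - 1) + \<sigma>)) \<le> \<epsilon> * (\<sigma> / (t j + \<sigma>)) powr \<rho>"
      if "j \<in> {1..M}" "K * t 1 \<le> \<sigma>" for j \<sigma>
      using quasi_graded_small[OF graded \<rho>(1,2) _ _ _ K' that] \<rho> \<alpha> c3 K by auto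
    show "stable \<alpha> \<gamma> lam0 lam1 t M C0 (g / c \<gamma> * D * C0)"
      unfolding stable_def
    proof (intro allI impI ballI)
      fix U n
      assume U0: "U 0 = 0" and n: "n \<in> {1..M}"
        and U: "\<forall>j\<in>{1..M}. L1_op \<alpha> t U j - lam0 * U j - lam1 * U (j - 1) \<le> C0 * (t 1 / t j) powr (\<gamma> + 1)"
      have t1: "0 < t 1" and tn: "0 < t n" "t n \<le> T" using t_pos[of 1] t_pos[of n] t_mono[of n M] n tM by auto
      \<comment> \<open>The largest scale must reach T. The number N of scales varies with the mesh,
        but no constant depends on it.\<close>
      obtain N0 where "T / (K * t 1) < 2 ^ N0" using real_arch_pow[of 2 "T / (K * t 1)"] by auto
      then have "T \<le> 2 ^ N0 * (K * t 1)" using K t1 by (simp add: pos_divide_less_eq)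
      then obtain N where N: "1 \<le> N" "T \<le> 2 ^ (N - 1) * (K * t 1)" using that[of "Suc N0"] by simp
      \<comment> \<open>The logarithm is frozen at \<open>t n\<close>, so the barrier depends on the index \<open>n\<close> to be bounded.\<close>
      define L where "L = t 1 powr (\<gamma>1 - \<gamma>) * log_factor \<gamma> (t 1) (t n)"
      have L: "0 \<le> L" using log_factor_ge_1[of n \<gamma>] n by (simp add: L_def)
      define P where "P \<delta> = power_sum \<delta> (K * t 1) N" for \<delta>
      have P0: "0 \<le> P \<delta> i" "P \<delta> 0 = 0" for \<delta> i by (auto simp: P_def power_sum_nonneg) (simp add: power_sum_def)
      have lower: "c \<gamma> * t j powr (- 1 - \<gamma>) \<le> L1_sum (P \<gamma>) j" "c \<gamma>2 * t j powr (- 1 - \<gamma>2) \<le> L1_sum (P \<gamma>2) j"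
        and upper: "P \<gamma> j \<le> A * L * t j powr (\<alpha> - 1 - \<gamma>1)" "P \<gamma>2 j \<le> A2 * t j powr (\<alpha> - 1 - \<gamma>2)"
        if j: "j \<in> {1..n}" for j
      proof -
        have j': "1 \<le> j" "j \<le> M" "j \<le> n" using j n by auto
        have tj: "0 < t j" "t j \<le> 2 ^ (N - 1) * (K * t 1)" using t_pos t_mono[of j M] j' tM N by auto
        show "c \<gamma> * t j powr (- 1 - \<gamma>) \<le> L1_sum (P \<gamma>) j"
          unfolding c_def P_def using \<epsilon>(1) \<epsilon>(2,3)[unfolded E_def] \<rho> \<gamma> K N tj j' small
          by (intro power_sum_lower) auto
        show "c \<gamma>2 * t j powr (- 1 - \<gamma>2) \<le> L1_sum (P \<gamma>2) j"
          unfolding c_def P_def using \<epsilon>(1) \<epsilon>(2,4)[unfolded E_def] \<rho> \<gamma>1 \<gamma>2 K N tj j' small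
          by (intro power_sum_lower) auto
        have "P \<gamma> j \<le> A * (t 1 powr (\<gamma>1 - \<gamma>) * log_factor \<gamma> (t 1) (t j)) * t j powr (\<alpha> - 1 - \<gamma>1)"
          unfolding P_def \<gamma>1_def using j' K N tj by (intro power_sum_upper A(2)) auto
        also have "\<dots> \<le> A * L * t j powr (\<alpha> - 1 - \<gamma>1)"
          unfolding L_def using A j' n log_factor_mono[of j n \<gamma>] by (intro mult_right_mono mult_left_mono) auto
        finally show "P \<gamma> j \<le> A * L * t j powr (\<alpha> - 1 - \<gamma>1)" .
        have "P \<gamma>2 j \<le> A2 * (t 1 powr (min \<gamma>2 0 - \<gamma>2) * log_factor \<gamma>2 (t 1) (t j)) * t j powr (\<alpha> - 1 - min \<gamma>2 0)"
          unfolding P_def using j' K N tj by (intro power_sum_upper A2(2)) auto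
        \<comment> \<open>Because \<open>\<gamma>2\<close> is negative there is neither a logarithm
          nor a power of \<open>t 1\<close>.\<close>
        then show "P \<gamma>2 j \<le> A2 * t j powr (\<alpha> - 1 - \<gamma>2)"
          using \<gamma>1 \<gamma>2 t1 by (simp add: log_factor_def)
      qed
      define B where "B i = P \<gamma> i + (L * P \<gamma>2 i + (2 * R * L) * exp_seq \<mu> i)" for i
      \<comment> \<open>Normalized so that \<kappa> times the residual of the first layer is exactly
        the load multiplied by \<open>Gamma (1 - \<alpha>)\<close>.\<close>
      define \<kappa> where "\<kappa> = g * C0 * t 1 powr (\<gamma> + 1) / c \<gamma>"
      have \<kappa>: "0 \<le> \<kappa>" using g C0 c[of \<gamma>] by (simp add: \<kappa>_def)
      have "U n \<le> \<kappa> * B n"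
      proof (rule le_barrier[where U = U and B = "\<lambda>i. \<kappa> * B i" and n = n])
        fix j assume j: "j \<in> {1..n}"
        then have j': "j \<in> {1..M}" "1 \<le> j" "j \<le> M" using n by auto
        have tj: "0 < t j" "t j \<le> T" using t_pos t_mono[of j M] j' tM by auto
        show "lam0 * mesh_step t j powr \<alpha> < 1 / Gamma (2 - \<alpha>)" using diag j' by simp
        show "L1_op \<alpha> t U j - lam0 * U j - lam1 * U (j - 1) \<le> C0 * (t 1 / t j) powr (\<gamma> + 1)"
          using U j' by simp
        have "P \<delta> (j - 1) \<le> 2 * P \<delta> j" for \<delta>
          unfolding P_def using power_sum_halving[of j "K * t 1"] small(1) j' K t1 by auto
        then have "B (j - 1) \<le> 2 * P \<gamma> j + (L * (2 * P \<gamma>2 j) + (2 * R * L) * (2 * exp_seq \<mu> j))"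
          unfolding B_def using L R exp_seq_halving[of \<mu> j] \<mu> j'
          by (intro add_mono mult_left_mono) auto
        then have "B (j - 1) \<le> 2 * B j" by (simp add: B_def algebra_simps)
        from mult_left_mono[OF this \<kappa>] show "\<kappa> * B (j - 1) \<le> 2 * (\<kappa> * B j)" by simp
        have exp: "t j powr (- \<alpha>) / 2 \<le> L1_sum (exp_seq \<mu>) j - lam * exp_seq \<mu> j"
          using exp_barrier[of j \<mu> lam] step lam \<mu> j'
          unfolding exp_seq_def[abs_def] lam_def g_def by auto
        have abs: "lam * A * t j powr (\<alpha> - 1 - \<gamma>1) + lam * A2 * t j powr (\<alpha> - 1 - \<gamma>2) \<le>
            c \<gamma>2 * t j powr (- 1 - \<gamma>2) + R * t j powr (- \<alpha>)"
          using R(2)[OF tj] by (simp add: algebra_simps)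
        have "L1_sum B j - lam * B j = (L1_sum (P \<gamma>) j - lam * P \<gamma> j) +
            (L * (L1_sum (P \<gamma>2) j - lam * P \<gamma>2 j) + 2 * R * L * (L1_sum (exp_seq \<mu>) j - lam * exp_seq \<mu> j))"
          unfolding B_def[abs_def] L1_sum_add L1_sum_cmult by (simp add: algebra_simps)
        also have "\<dots> \<ge> (c \<gamma> * t j powr (- 1 - \<gamma>) - lam * (A * L * t j powr (\<alpha> - 1 - \<gamma>1))) +
            (L * (c \<gamma>2 * t j powr (- 1 - \<gamma>2) - lam * (A2 * t j powr (\<alpha> - 1 - \<gamma>2))) +
             2 * R * L * (t j powr (- \<alpha>) / 2))"
          using lower[OF j] upper[OF j] lam L R exp
          by (intro add_mono mult_left_mono diff_mono) auto
        also have "(c \<gamma> * t j powr (- 1 - \<gamma>) - lam * (A * L * t j powr (\<alpha> - 1 - \<gamma>1))) +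
            (L * (c \<gamma>2 * t j powr (- 1 - \<gamma>2) - lam * (A2 * t j powr (\<alpha> - 1 - \<gamma>2))) +
             2 * R * L * (t j powr (- \<alpha>) / 2)) =
            c \<gamma> * t j powr (- 1 - \<gamma>) + L * ((c \<gamma>2 * t j powr (- 1 - \<gamma>2) + R * t j powr (- \<alpha>)) -
              (lam * A * t j powr (\<alpha> - 1 - \<gamma>1) + lam * A2 * t j powr (\<alpha> - 1 - \<gamma>2)))"
          by (simp add: algebra_simps)
        finally have "c \<gamma> * t j powr (- 1 - \<gamma>) \<le> L1_sum B j - lam * B j"
          using mult_nonneg_nonneg[OF L, of "(c \<gamma>2 * t j powr (- 1 - \<gamma>2) + R * t j powr (- \<alpha>)) -
              (lam * A * t j powr (\<alpha> - 1 - \<gamma>1) + lam * A2 * t j powr (\<alpha> - 1 - \<gamma>2))"] abs by simp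
        then have "\<kappa> * (c \<gamma> * t j powr (- 1 - \<gamma>)) \<le> \<kappa> * (L1_sum B j - lam * B j)"
          using \<kappa> by (rule mult_left_mono)
        moreover have "\<kappa> * (c \<gamma> * t j powr (- 1 - \<gamma>)) = g * (C0 * (t 1 / t j) powr (\<gamma> + 1))"
        proof -
          have "t j powr (- 1 - \<gamma>) = 1 / t j powr (\<gamma> + 1)"
            using powr_minus_divide[of "t j" "\<gamma> + 1"] by (simp add: algebra_simps)
          then show ?thesis using c[of \<gamma>] t1 tj by (simp add: \<kappa>_def powr_divide)
        qed
        ultimately show "Gamma (1 - \<alpha>) * (C0 * (t 1 / t j) powr (\<gamma> + 1)) \<le>
            L1_sum (\<lambda>i. \<kappa> * B i) j - Gamma (1 - \<alpha>) * (lam0 + 2 * lam1) * (\<kappa> * B j)"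
          unfolding L1_sum_cmult g_def[symmetric] lam_def by (simp add: algebra_simps)
      qed (use lam01 n U0 P0 in \<open>auto simp: B_def exp_seq_def\<close>)
      also have "B n \<le> D * (L * t n powr (\<alpha> - 1 - \<gamma>1))"
      proof -
        let ?q = "t n powr (\<alpha> - 1 - \<gamma>1)"
        have n': "n \<in> {1..n}" using n by simp
        have "t n powr (\<alpha> - 1 - \<gamma>2) = t n powr (\<gamma>1 - \<gamma>2) * ?q" by (simp flip: powr_add)
        also have "\<dots> \<le> T powr (\<gamma>1 - \<gamma>2) * ?q"
          using tn \<gamma>2 by (intro mult_right_mono powr_mono2) auto
        finally have "A2 * t n powr (\<alpha> - 1 - \<gamma>2) \<le> A2 * (T powr (\<gamma>1 - \<gamma>2) * ?q)"
          using A2 by (intro mult_left_mono) auto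
        then have 2: "P \<gamma>2 n \<le> A2 * (T powr (\<gamma>1 - \<gamma>2) * ?q)" using upper(2)[OF n'] by linarith
        have "1 = t n powr (1 + \<gamma>1 - \<alpha>) * ?q" using tn by (simp flip: powr_add)
        also have "\<dots> \<le> T powr (1 + \<gamma>1 - \<alpha>) * ?q"
          using tn \<gamma>1 by (intro mult_right_mono powr_mono2) auto
        finally have "exp (\<mu> * t n) * 1 \<le> exp (\<mu> * T) * (T powr (1 + \<gamma>1 - \<alpha>) * ?q)"
          using tn \<mu> by (intro mult_mono) auto
        then have 3: "exp_seq \<mu> n \<le> exp (\<mu> * T) * (T powr (1 + \<gamma>1 - \<alpha>) * ?q)"
          using n by (simp add: exp_seq_def)
        have "B n \<le> A * L * ?q + (L * (A2 * (T powr (\<gamma>1 - \<gamma>2) * ?q)) +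
            (2 * R * L) * (exp (\<mu> * T) * (T powr (1 + \<gamma>1 - \<alpha>) * ?q)))"
          unfolding B_def using upper(1)[OF n'] 2 3 L R by (intro add_mono mult_left_mono) auto
        also have "\<dots> = D * (L * ?q)" by (simp add: D_def algebra_simps)
        finally show ?thesis .
      qed
      then have "\<kappa> * B n \<le> \<kappa> * (D * (L * t n powr (\<alpha> - 1 - \<gamma>1)))" using \<kappa> by (rule mult_left_mono)
      also have "\<dots> = g / c \<gamma> * D * C0 * decay_bound \<alpha> \<gamma> (t 1) (t n)"
      proof -
        have "t 1 powr (\<gamma> + 1) * t 1 powr (\<gamma>1 - \<gamma>) = t 1 * t 1 powr \<gamma>1"
          using t1 powr_add[of "t 1" 1 \<gamma>1] by (simp flip: powr_add)
        moreover have "t n powr (\<alpha> - 1 - \<gamma>1) = t n powr (\<alpha> - 1) / t n powr \<gamma>1" by (simp add: powr_diff)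
        ultimately have "t 1 powr (\<gamma> + 1) * t 1 powr (\<gamma>1 - \<gamma>) * t n powr (\<alpha> - 1 - \<gamma>1) =
            t 1 * t n powr (\<alpha> - 1) * (t 1 / t n) powr (min 0 \<gamma>)"
          using t1 tn by (simp add: powr_divide \<gamma>1_def min.commute)
        moreover have "\<kappa> * (D * (L * t n powr (\<alpha> - 1 - \<gamma>1))) = g / c \<gamma> * D * C0 * (log_factor \<gamma> (t 1) (t n) *
            (t 1 powr (\<gamma> + 1) * t 1 powr (\<gamma>1 - \<gamma>) * t n powr (\<alpha> - 1 - \<gamma>1)))"
          by (simp add: \<kappa>_def L_def)
        ultimately show ?thesis by (simp add: decay_bound_def mult.assoc)
      qed
      finally show "U n \<le> g / c \<gamma> * D * C0 * decay_bound \<alpha> \<gamma> (t 1) (t n)" .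
    qed
  qed
qed

lemma (in L1_mesh) stable_regular:
  assumes diag: "\<And>j. j \<in> {1..M} \<Longrightarrow> lam0 * mesh_step t j powr \<alpha> < 1 / Gamma (2 - \<alpha>)"
    and lam: "0 \<le> lam0" "0 \<le> lam1"
    and \<mu>: "0 < \<mu>" "6 * (Gamma (1 - \<alpha>) * (lam0 + 2 * lam1)) \<le> \<mu> powr \<alpha>"
    and step: "\<And>j. j \<in> {1..M} \<Longrightarrow> mesh_step t j \<le> 1 / \<mu>"
    and \<gamma>: "\<gamma> \<le> \<alpha> - 1" and C0: "0 \<le> C0" and T: "t M \<le> T"
  shows "stable \<alpha> \<gamma> lam0 lam1 t M C0 (2 * C0 * Gamma (1 - \<alpha>) * exp (\<mu> * T))"
  unfolding stable_def
proof (intro allI impI ballI)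
  fix U n
  assume U: "U 0 = 0" "\<forall>j\<in>{1..M}. L1_op \<alpha> t U j - lam0 * U j - lam1 * U (j - 1) \<le> C0 * (t 1 / t j) powr (\<gamma> + 1)"
    and n: "n \<in> {1..M}"
  have "\<gamma> < 0" using \<gamma> \<alpha> by simp
  then have b: "t 1 * t n powr (\<alpha> - 1) * (t 1 / t n) powr \<gamma> = decay_bound \<alpha> \<gamma> (t 1) (t n)"
    by (simp add: decay_bound_def log_factor_def min_absorb2)
  have "U n \<le> 2 * C0 * Gamma (1 - \<alpha>) * exp (\<mu> * t n) * t 1 * t n powr (\<alpha> - 1) * (t 1 / t n) powr \<gamma>"
    using stability_regular[where U = U and n = n, OF diag lam \<mu> step \<gamma> C0] U n by auto
  also have "\<dots> = 2 * C0 * Gamma (1 - \<alpha>) * exp (\<mu> * t n) * decay_bound \<alpha> \<gamma> (t 1) (t n)"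
    unfolding b[symmetric] by simp
  also have "\<dots> \<le> 2 * C0 * Gamma (1 - \<alpha>) * exp (\<mu> * T) * decay_bound \<alpha> \<gamma> (t 1) (t n)"
  proof -
    have "t n \<le> T" using t_mono[of n M] n T by auto
    moreover have "0 < Gamma (1 - \<alpha>)" using \<alpha> by (auto intro: Gamma_real_pos)
    ultimately show ?thesis
      using C0 \<mu> n decay_bound_pos[of n \<gamma>] by (intro mult_right_mono mult_left_mono) auto
  qed
  finally show "U n \<le> 2 * C0 * Gamma (1 - \<alpha>) * exp (\<mu> * T) * decay_bound \<alpha> \<gamma> (t 1) (t n)" .
qed

text \<open>Since \<open>t 1 / t j \<le> 1\<close>, a larger exponent restricts U more, while
  \<open>decay_bound\<close> takes the same value for all positive exponents.\<close>

lemma (in L1_mesh) stable_increase_exponent: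
  assumes st: "stable \<alpha> \<delta> lam0 lam1 t M C0 C" and \<delta>: "0 < \<delta>" "\<delta> \<le> \<gamma>" and C0: "0 \<le> C0"
  shows "stable \<alpha> \<gamma> lam0 lam1 t M C0 C"
  unfolding stable_def
proof (intro allI impI)
  fix U
  assume U: "U 0 = 0" "\<forall>j\<in>{1..M}. L1_op \<alpha> t U j - lam0 * U j - lam1 * U (j - 1) \<le> C0 * (t 1 / t j) powr (\<gamma> + 1)"
  have "L1_op \<alpha> t U j - lam0 * U j - lam1 * U (j - 1) \<le> C0 * (t 1 / t j) powr (\<delta> + 1)" if j: "j \<in> {1..M}" for j
  proof -
    have "(t 1 / t j) powr (\<gamma> + 1) \<le> (t 1 / t j) powr (\<delta> + 1)"
      using \<delta> t_pos[of j] t_pos[of 1] t_1_le[of j] j by (intro powr_mono') auto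
    then have "C0 * (t 1 / t j) powr (\<gamma> + 1) \<le> C0 * (t 1 / t j) powr (\<delta> + 1)"
      using C0 by (rule mult_left_mono)
    then show ?thesis using U(2) j by (meson order_trans)
  qed
  then have "\<forall>j\<in>{1..M}. U j \<le> C * decay_bound \<alpha> \<delta> (t 1) (t j)"
    using st U(1) unfolding stable_def by blast
  then show "\<forall>j\<in>{1..M}. U j \<le> C * decay_bound \<alpha> \<gamma> (t 1) (t j)"
    using \<delta> by (simp add: decay_bound_def log_factor_def)
qed

lemma stable_fine_quasi_graded:
  fixes \<alpha> \<gamma> r c3 T \<mu> lam0 lam1 C0 :: real
  assumes \<alpha>: "0 < \<alpha>" "\<alpha> < 1" and lam01: "0 \<le> lam0" "0 \<le> lam1"
    and \<mu>: "0 < \<mu>" "6 * (Gamma (1 - \<alpha>) * (lam0 + 2 * lam1)) \<le> \<mu> powr \<alpha>"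
    and r: "1 \<le> r" and c3: "0 < c3" and T: "0 < T" and C0: "0 < C0"
  obtains C where "0 < C"
    "\<And>t M. L1_mesh \<alpha> t M \<Longrightarrow> t M \<le> T \<Longrightarrow>
      (\<And>j. j \<in> {1..M} \<Longrightarrow> lam0 * mesh_step t j powr \<alpha> < 1 / Gamma (2 - \<alpha>)) \<Longrightarrow>
      (\<And>j. j \<in> {1..M} \<Longrightarrow> mesh_step t j \<le> c3 * t 1 powr (1 / r) * t j powr (1 - 1 / r)) \<Longrightarrow>
      (\<And>j. j \<in> {1..M} \<Longrightarrow> mesh_step t j \<le> 1 / \<mu>) \<Longrightarrow>
      stable \<alpha> \<gamma> lam0 lam1 t M C0 C"
proof (cases "\<gamma> \<le> \<alpha> - 1")
  case True
  have G: "0 < Gamma (1 - \<alpha>)" using \<alpha> by (auto intro: Gamma_real_pos)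
  show ?thesis
  proof (rule that)
    show "0 < 2 * C0 * Gamma (1 - \<alpha>) * exp (\<mu> * T)" using G C0 by simp
  qed (use L1_mesh.stable_regular lam01 \<mu> True C0 in auto)
next
  case False
  \<comment> \<open>At most 1 / r for the grading; the halving makes it strictly smaller than
    \<alpha>.\<close>
  define \<rho> where "\<rho> = min \<alpha> (1 / r) / 2"
  have \<rho>: "0 < \<rho>" "\<rho> \<le> 1 / r" "\<rho> < \<alpha>"
  proof -
    define q where "q = 1 / r"
    have "0 < q" using r by (simp add: q_def)
    then show "0 < \<rho>" "\<rho> \<le> 1 / r" "\<rho> < \<alpha>"
      using \<alpha> unfolding \<rho>_def q_def[symmetric] by (auto simp: min_def)
  qed
  \<comment> \<open>Exponents from \<rho> upwards are outside the range of the dyadic sums, so a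
    positive exponent below \<rho> replaces them.\<close>
  define \<delta> where "\<delta> = (if \<gamma> < \<rho> then \<gamma> else \<rho> / 2)"
  have \<delta>: "\<alpha> - 1 < \<delta>" "\<delta> < \<rho>" using False \<rho> \<alpha> by (auto simp: \<delta>_def)
  obtain C where C: "0 < C"
    "\<And>t M C0. L1_mesh \<alpha> t M \<Longrightarrow> t M \<le> T \<Longrightarrow> 0 \<le> C0 \<Longrightarrow>
      (\<And>j. j \<in> {1..M} \<Longrightarrow> lam0 * mesh_step t j powr \<alpha> < 1 / Gamma (2 - \<alpha>)) \<Longrightarrow>
      (\<And>j. j \<in> {1..M} \<Longrightarrow> mesh_step t j \<le> c3 * t 1 powr (1 / r) * t j powr (1 - 1 / r)) \<Longrightarrow>
      (\<And>j. j \<in> {1..M} \<Longrightarrow> mesh_step t j \<le> 1 / \<mu>) \<Longrightarrow>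
      stable \<alpha> \<delta> lam0 lam1 t M C0 (C * C0)"
    by (rule stable_singular[OF \<alpha> lam01 \<mu> \<rho> \<delta> c3 T]) blast
  show ?thesis
  proof (rule that)
    show "0 < C * C0" using C C0 by simp
    fix t M
    assume mesh: "L1_mesh \<alpha> t M" "t M \<le> T"
      "\<And>j. j \<in> {1..M} \<Longrightarrow> lam0 * mesh_step t j powr \<alpha> < 1 / Gamma (2 - \<alpha>)"
      "\<And>j. j \<in> {1..M} \<Longrightarrow> mesh_step t j \<le> c3 * t 1 powr (1 / r) * t j powr (1 - 1 / r)"
      "\<And>j. j \<in> {1..M} \<Longrightarrow> mesh_step t j \<le> 1 / \<mu>"
    have "stable \<alpha> \<delta> lam0 lam1 t M C0 (C * C0)"
      using C(2)[OF mesh(1,2) _ mesh(3-5)] C0 by simp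
    then show "stable \<alpha> \<gamma> lam0 lam1 t M C0 (C * C0)"
      using L1_mesh.stable_increase_exponent[OF mesh(1), of \<delta> lam0 lam1 C0 "C * C0" \<gamma>] C0 \<rho>
      by (cases "\<gamma> < \<rho>") (auto simp: \<delta>_def)
  qed
qed

section \<open>Uniformity over the family of meshes\<close>

lemma quasi_graded_step_le:
  fixes r c2 c3 T \<tau> x m :: real
  assumes "1 \<le> r" "0 < c2" "0 < c3" "0 < m" "0 < \<tau>" "\<tau> \<le> c2 * m powr (- r)" "0 < x" "x \<le> T"
  shows "c3 * \<tau> powr (1 / r) * x powr (1 - 1 / r) \<le> c3 * c2 powr (1 / r) * T powr (1 - 1 / r) / m"
proof -
  have "\<tau> powr (1 / r) \<le> (c2 * m powr (- r)) powr (1 / r)" using assms by (intro powr_mono2) auto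
  also have "\<dots> = c2 powr (1 / r) * m powr (- 1)" using assms by (simp add: powr_mult powr_powr)
  also have "\<dots> = c2 powr (1 / r) / m" using assms powr_minus_divide[of m 1] by simp
  finally have "c3 * \<tau> powr (1 / r) * x powr (1 - 1 / r) \<le> c3 * (c2 powr (1 / r) / m) * T powr (1 - 1 / r)"
    using assms by (intro mult_mono powr_mono2) auto
  then show ?thesis by simp
qed

text \<open>Only finitely many M lie below \<open>M0\<close>; adding their individual constants to
  the eventual one gives a common constant.\<close>

lemma family_bound_from_eventual:
  fixes P :: "nat \<Rightarrow> real \<Rightarrow> bool"
  assumes mono: "\<And>M C C'. M \<in> Ms \<Longrightarrow> P M C \<Longrightarrow> C \<le> C' \<Longrightarrow> P M C'"
    and single: "\<And>M. M \<in> Ms \<Longrightarrow> \<exists>C>0. P M C"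
    and eventual: "0 < C" "\<And>M. M \<in> Ms \<Longrightarrow> M0 \<le> M \<Longrightarrow> P M C"
  shows "\<exists>C>0. \<forall>M\<in>Ms. P M C"
proof -
  obtain D where D: "\<And>M. M \<in> Ms \<Longrightarrow> 0 < D M \<and> P M (D M)"
    using single by metis
  define S where "S = (\<Sum>M\<in>Ms \<inter> {..<M0}. D M)"
  have pos: "0 \<le> D M" if "M \<in> Ms \<inter> {..<M0}" for M using D[of M] that by (simp add: less_imp_le)
  have S: "0 \<le> S" unfolding S_def by (intro sum_nonneg pos)
  have "P M (C + S)" if M: "M \<in> Ms" for M
  proof (cases "M0 \<le> M")
    case True
    then show ?thesis using mono[OF M eventual(2)[OF M True]] S by simp
  next
    case False
    then have "D M \<le> S" unfolding S_def using M pos by (intro member_le_sum) auto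
    then show ?thesis using mono[OF M, of "D M" "C + S"] D[OF M] eventual(1) by simp
  qed
  then show ?thesis using eventual(1) S by (intro exI[of _ "C + S"]) auto
qed

lemma L1_mesh_temporal_mesh:
  assumes "0 < \<alpha>" "\<alpha> < 1" "temporal_mesh T M t"
  shows "L1_mesh \<alpha> t M"
  using assms unfolding temporal_mesh_def by unfold_locales auto

lemma stable_family:
  fixes T \<alpha> \<gamma> lam0 lam1 \<mu> C0 :: real
  assumes T: "0 < T" and \<alpha>: "0 < \<alpha>" "\<alpha> < 1" and lam01: "0 \<le> lam0" "0 \<le> lam1"
    and \<mu>: "0 < \<mu>" "6 * (Gamma (1 - \<alpha>) * (lam0 + 2 * lam1)) \<le> \<mu> powr \<alpha>"
    and family: "mesh_family T Ms t"
    and diag: "\<forall>M\<in>Ms. \<forall>j\<in>{1..M}. lam0 * mesh_step (t M) j powr \<alpha> < 1 / Gamma (2 - \<alpha>)"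
    and alt: "(\<exists>r\<ge>1. quasi_graded Ms t r) \<or> (\<gamma> \<le> \<alpha> - 1 \<and> (\<forall>M\<in>Ms. max_mesh_step (t M) M \<le> 1 / \<mu>))"
    and C0: "0 < C0"
  shows "\<exists>C1>0. \<forall>M\<in>Ms. stable \<alpha> \<gamma> lam0 lam1 (t M) M C0 C1"
proof -
  have temporal: "temporal_mesh T M (t M)" if "M \<in> Ms" for M
    using family that by (simp add: mesh_family_def)
  then have mesh: "L1_mesh \<alpha> (t M) M" and tM: "t M M = T" "1 \<le> M" if "M \<in> Ms" for M
    using L1_mesh_temporal_mesh[OF \<alpha>] that by (auto simp: temporal_mesh_def)
  from alt show ?thesis
  proof (elim disjE exE conjE)
    fix r assume r: "1 \<le> r" and "quasi_graded Ms t r"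
    then obtain c1 c2 c3 where c: "0 < c1" "0 < c2" "0 < c3"
      and all: "\<forall>M\<in>Ms. c1 * real M powr (- r) \<le> t M 1 \<and> t M 1 \<le> c2 * real M powr (- r) \<and>
        (\<forall>j\<in>{1..M}. mesh_step (t M) j \<le> c3 * t M 1 powr (1 / r) * t M j powr (1 - 1 / r))"
      unfolding quasi_graded_def by blast
    have first: "t M 1 \<le> c2 * real M powr (- r)"
      and step: "\<And>j. j \<in> {1..M} \<Longrightarrow> mesh_step (t M) j \<le> c3 * t M 1 powr (1 / r) * t M j powr (1 - 1 / r)"
      if "M \<in> Ms" for M
      using all that by auto
    obtain C where C: "0 < C" "\<And>t M. L1_mesh \<alpha> t M \<Longrightarrow> t M \<le> T \<Longrightarrow>
      (\<And>j. j \<in> {1..M} \<Longrightarrow> lam0 * mesh_step t j powr \<alpha> < 1 / Gamma (2 - \<alpha>)) \<Longrightarrow>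
      (\<And>j. j \<in> {1..M} \<Longrightarrow> mesh_step t j \<le> c3 * t 1 powr (1 / r) * t j powr (1 - 1 / r)) \<Longrightarrow>
      (\<And>j. j \<in> {1..M} \<Longrightarrow> mesh_step t j \<le> 1 / \<mu>) \<Longrightarrow>
      stable \<alpha> \<gamma> lam0 lam1 t M C0 C"
      by (rule stable_fine_quasi_graded[OF \<alpha> lam01 \<mu> r c(3) T C0, of \<gamma>]) blast
    define Q where "Q = c3 * c2 powr (1 / r) * T powr (1 - 1 / r)"
    show ?thesis
    \<comment> \<open>Steps are at most Q / M, so M \<ge> Q * \<mu> makes the mesh fine enough for
      the exponential barrier.\<close>
    proof (rule family_bound_from_eventual[of Ms "\<lambda>M. stable \<alpha> \<gamma> lam0 lam1 (t M) M C0" C "nat \<lceil>Q * \<mu>\<rceil>"])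
      fix M assume M: "M \<in> Ms" and large: "nat \<lceil>Q * \<mu>\<rceil> \<le> M"
      have fine: "mesh_step (t M) j \<le> 1 / \<mu>" if j: "j \<in> {1..M}" for j
      proof -
        interpret L1_mesh \<alpha> "t M" M by (rule mesh[OF M])
        have "mesh_step (t M) j \<le> Q / real M"
          using step[OF M j] quasi_graded_step_le[of r c2 c3 "real M" "t M 1" "t M j" T] r c first[OF M]
            t_pos[of 1] t_pos[of j] t_mono[of j M] tM[OF M] j unfolding Q_def by auto
        also have "\<dots> \<le> 1 / \<mu>"
          using large tM[OF M] \<mu> by (simp add: field_simps nat_le_iff ceiling_le_iff)
        finally show ?thesis .
      qed
      show "stable \<alpha> \<gamma> lam0 lam1 (t M) M C0 C"
        using C(2)[OF mesh[OF M]] tM[OF M] diag M step fine by auto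
    next
      fix M assume M: "M \<in> Ms"
      show "\<exists>C>0. stable \<alpha> \<gamma> lam0 lam1 (t M) M C0 C"
        using L1_mesh.stable_single_mesh[OF mesh[OF M]] diag M lam01 by blast
    qed (use C L1_mesh.stable_mono[OF mesh] in auto)
  next
    assume \<gamma>: "\<gamma> \<le> \<alpha> - 1" and max: "\<forall>M\<in>Ms. max_mesh_step (t M) M \<le> 1 / \<mu>"
    have "mesh_step (t M) j \<le> 1 / \<mu>" if "M \<in> Ms" "j \<in> {1..M}" for M j
    proof -
      have "mesh_step (t M) j \<le> max_mesh_step (t M) M"
        unfolding max_mesh_step_def using that by (intro Max_ge) auto
      then show ?thesis using max that by fastforce
    qed
    then have "\<forall>M\<in>Ms. stable \<alpha> \<gamma> lam0 lam1 (t M) M C0 (2 * C0 * Gamma (1 - \<alpha>) * exp (\<mu> * T))"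
      using L1_mesh.stable_regular[OF mesh _ lam01 \<mu> _ \<gamma>] diag C0 tM by auto
    moreover have "0 < 2 * C0 * Gamma (1 - \<alpha>) * exp (\<mu> * T)"
      using \<alpha> C0 by (auto intro: Gamma_real_pos)
    ultimately show ?thesis by blast
  qed
qed

theorem theorem2p2:
  fixes T \<alpha> \<gamma> lam0 lam1 :: real
  assumes "T > 0" and "0 < \<alpha>" and "\<alpha> < 1" and "lam0 \<ge> 0" and "lam1 \<ge> 0"
  shows "\<exists>\<delta>0>0. \<forall>(Ms :: nat set) (t :: nat \<Rightarrow> nat \<Rightarrow> real).
    mesh_family T Ms t \<longrightarrow>
    (\<forall>M\<in>Ms. \<forall>j\<in>{1..M}. lam0 * mesh_step (t M) j powr \<alpha> < 1 / Gamma (2 - \<alpha>)) \<longrightarrow>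
    (\<exists>r\<ge>1. quasi_graded Ms t r) \<or>
      (\<gamma> \<le> \<alpha> - 1 \<and> (\<forall>M\<in>Ms. max_mesh_step (t M) M \<le> \<delta>0)) \<longrightarrow>
    (\<forall>C0>0. \<exists>C1>0. \<forall>M\<in>Ms. \<forall>U :: nat \<Rightarrow> real.
      U 0 = 0 \<longrightarrow>
      (\<forall>j\<in>{1..M}. (L1_op \<alpha> (t M) U j - lam0 * U j) - lam1 * U (j - 1)
          \<le> C0 * (t M 1 / t M j) powr (\<gamma> + 1)) \<longrightarrow>
      (\<forall>j\<in>{1..M}. U j \<le> C1 * log_factor \<gamma> (t M 1) (t M j) * t M 1 * t M j powr (\<alpha> - 1)
          * (t M 1 / t M j) powr (min 0 \<gamma>)))"
proof -
  \<comment> \<open>The 6 comes from the exponential barrier, and the added 1 keeps b positive when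
    \<open>lam0\<close> and \<open>lam1\<close> vanish; \<mu> is then the solution of
    \<open>\<mu> powr \<alpha> = b\<close>.\<close>
  define b where "b = 6 * (Gamma (1 - \<alpha>) * (lam0 + 2 * lam1)) + 1"
  define \<mu> where "\<mu> = b powr (1 / \<alpha>)"
  have "0 < Gamma (1 - \<alpha>)" using assms by (auto intro: Gamma_real_pos)
  then have b: "0 < b" unfolding b_def using assms by (intro add_nonneg_pos) auto
  then have \<mu>: "0 < \<mu>" "6 * (Gamma (1 - \<alpha>) * (lam0 + 2 * lam1)) \<le> \<mu> powr \<alpha>"
    using assms by (auto simp: \<mu>_def powr_powr b_def)
  show ?thesis
  \<comment> \<open>The threshold is the step length allowed by the exponential barrier; it depends
    only on \<alpha>, \<open>lam0\<close> and \<open>lam1\<close>.\<close>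
  proof (rule exI[of _ "1 / \<mu>"], intro conjI allI impI)
    fix Ms :: "nat set" and t :: "nat \<Rightarrow> nat \<Rightarrow> real" and C0 :: real
    assume "mesh_family T Ms t"
      "\<forall>M\<in>Ms. \<forall>j\<in>{1..M}. lam0 * mesh_step (t M) j powr \<alpha> < 1 / Gamma (2 - \<alpha>)"
      "(\<exists>r\<ge>1. quasi_graded Ms t r) \<or> (\<gamma> \<le> \<alpha> - 1 \<and> (\<forall>M\<in>Ms. max_mesh_step (t M) M \<le> 1 / \<mu>))"
      "0 < C0"
    from stable_family[OF assms \<mu> this]
    show "\<exists>C1>0. \<forall>M\<in>Ms. \<forall>U :: nat \<Rightarrow> real. U 0 = 0 \<longrightarrow>
      (\<forall>j\<in>{1..M}. (L1_op \<alpha> (t M) U j - lam0 * U j) - lam1 * U (j - 1)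
          \<le> C0 * (t M 1 / t M j) powr (\<gamma> + 1)) \<longrightarrow>
      (\<forall>j\<in>{1..M}. U j \<le> C1 * log_factor \<gamma> (t M 1) (t M j) * t M 1 * t M j powr (\<alpha> - 1)
          * (t M 1 / t M j) powr (min 0 \<gamma>))"
      unfolding stable_def decay_bound_def by (simp only: mult.assoc)
  qed (use \<mu> in simp)
qed

end
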